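(* Let $\lambda\in(0,1)$. If $H_1,\ldots,H_n$ are linear hyperplanes of $\mathbb{R}^n$ with $H_1\cap\ldots\cap H_n=\{o\}$, and the convex bodies $K$ and $L$ in $\mathbb{R}^n$ are invariant under the orthogonal reflections through $H_1,\ldots,H_n$, then $$\gamma((1-\lambda)\cdot K +_0 \lambda\cdot L)\geq \gamma(K)^{1-\lambda}\, \gamma(L)^\lambda ,$$ where $\gamma$ is the standard Gaussian measure on $\mathbb{R}^n$.
   Context: A convex body in $\mathbb{R}^n$ is a compact convex set with non-empty interior; $o$ is the origin. The Gaussian measure is $d\gamma(x)=\frac1{(2\pi)^{n/2}}\exp(-\|x\|^2/2)\,dx$ with $\|\cdot\|$ the Euclidean norm. A set $X$ is invariant under a linear map $A$ if $AX=X$. The support function of a compact convex set $K$ is $h_K(u)=\max\{\langle u,y\rangle: y\in K\}$. For convex bodies $K,L$ with $o$ in their interiors (automatically the case under the invariance hypothesis of the claim), the $L_0$-sum is $$(1-\lambda)\cdot K+_0\lambda\cdot L=\{x\in\mathbb{R}^n:\langle x,u\rangle\leq h_K(u)^{1-\lambda}h_L(u)^{\lambda}\ \ \forall u\in S^{n-1}\}.$$ *)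

theory Defs
  imports "HOL-Analysis.Analysis"
begin

definition convex_body :: "'a::euclidean_space set \<Rightarrow> bool" where
  "convex_body K \<longleftrightarrow> compact K \<and> convex K \<and> interior K \<noteq> {}"

definition linear_hyperplane :: "'a::euclidean_space set \<Rightarrow> bool" where
  "linear_hyperplane H \<longleftrightarrow> subspace H \<and> dim H = DIM('a) - 1"

definition orthogonal_projection :: "'a::euclidean_space set \<Rightarrow> 'a \<Rightarrow> 'a" where
  "orthogonal_projection H x = (THE p. p \<in> H \<and> (\<forall>h\<in>H. orthogonal (x - p) h))"

definition orthogonal_reflection :: "'a::euclidean_space set \<Rightarrow> 'a \<Rightarrow> 'a" where
  "orthogonal_reflection H x = 2 *\<^sub>R orthogonal_projection H x - x"

definition invariant_under :: "('a \<Rightarrow> 'a) \<Rightarrow> 'a set \<Rightarrow> bool" where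
  "invariant_under A X \<longleftrightarrow> A ` X = X"

(* For nonempty compact K the supremum is attained, so it is the maximum. *)
definition support_function :: "'a::euclidean_space set \<Rightarrow> 'a \<Rightarrow> real" where
  "support_function K u = (SUP y\<in>K. u \<bullet> y)"

(* Meant for K and L with the origin in their interiors: both support functions are
   then positive on the unit sphere, and powr is the ordinary real power. *)
definition L0_sum :: "real \<Rightarrow> 'a::euclidean_space set \<Rightarrow> 'a set \<Rightarrow> 'a set" where
  "L0_sum t K L =
     {x. \<forall>u\<in>sphere 0 1. x \<bullet> u \<le> support_function K u powr (1 - t) * support_function L u powr t}"

definition gaussian_measure :: "'a::euclidean_space measure" where
  "gaussian_measure =
     density lborel (\<lambda>x::'a. ennreal (1 / (2 * pi) powr (real DIM('a) / 2) * exp (- (norm x)\<^sup>2 / 2)))"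

lemma orthogonal_projection_eqI:
  assumes "subspace H" "p \<in> H" "\<And>h. h \<in> H \<Longrightarrow> orthogonal (x - p) h"
  shows "orthogonal_projection H x = p"
  unfolding orthogonal_projection_def
proof (rule the_equality)
  show "p \<in> H \<and> (\<forall>h\<in>H. orthogonal (x - p) h)"
    using assms by blast
next
  fix q assume q: "q \<in> H \<and> (\<forall>h\<in>H. orthogonal (x - q) h)"
  then have "q - p \<in> H"
    using assms by (simp add: subspace_diff)
  then have "(x - p) \<bullet> (q - p) = 0" "(x - q) \<bullet> (q - p) = 0"
    using assms(3) q by (auto simp: orthogonal_def)
  then have "(q - p) \<bullet> (q - p) = 0"
    by (simp add: inner_diff_left)
  then show "q = p"
    by simp
qed

lemma orthogonal_reflection_hyperplane:
  fixes a :: "'a::euclidean_space"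
  assumes "a \<noteq> 0"
  shows "orthogonal_reflection {x. a \<bullet> x = 0} x = x - (2 * (a \<bullet> x) / (a \<bullet> a)) *\<^sub>R a"
proof -
  have "orthogonal_projection {x. a \<bullet> x = 0} x = x - ((a \<bullet> x) / (a \<bullet> a)) *\<^sub>R a"
    using assms
    by (intro orthogonal_projection_eqI)
      (auto simp: subspace_hyperplane inner_diff_right orthogonal_def)
  then show ?thesis
    by (simp add: orthogonal_reflection_def scaleR_diff_right scaleR_2)
qed

end

theory Submission
  imports Defs "HOL-Probability.Distributions"
begin

text \<open>The unit normals \<open>a\<close> whose reflections preserve both \<open>K\<close> and \<open>L\<close> form a closed set that is
  stable under its own reflections and spans the space. If it is infinite it contains a great
  circle, and induction on the dimension yields a finite spanning subset \<open>R\<close> that is still stable.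
  The hyperplanes of \<open>R\<close> cut the space into finitely many congruent chambers. Each chamber is
  a simplicial cone, and in the coordinates \<open>T\<close> given by its extreme rays, which enclose
  non-obtuse angles, it is the positive orthant. There the coordinatewise geometric mean of
  points of \<open>K\<close> and \<open>L\<close> lies in the \<open>L\<^sub>0\<close>-sum by Hoelder's inequality, because each \<open>u\<close> may be
  replaced by a dominant element of its orbit; and \<open>norm (T y)\<^sup>2\<close> is a quadratic form in the
  coordinates of \<open>y\<close> with nonnegative coefficients. The Prekopa-Leindler inequality in
  exponential coordinates thus gives the claim on every chamber, and the chambers contribute
  equally for \<open>K\<close> and for \<open>L\<close>.\<close>

section \<open>The Prekopa-Leindler inequality on the positive orthant\<close>

text \<open>The given reflections may generate an infinite group (two mirrors at an irrational
  multiple of pi suffice), and its mirrors then leave no open chamber. Passing to all normals of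
  common reflections makes the set of roots closed, so that limits of roots are again roots; a
  finite subsystem that still spans is all that the chamber argument requires. Why non-obtuse rays
  matter: in chamber coordinates a monomial \<open>(x \<bullet> b) * (x \<bullet> b')\<close> at the
  coordinatewise geometric mean is the geometric mean of the two given monomials, hence at most
  their arithmetic mean. Nonnegative coefficients carry this over to the quadratic form, so the
  Gaussian density at the mean is at least the weighted geometric mean of the densities; a negative
  coefficient would reverse the estimate for its monomial. The rays are non-obtuse because they form
  the basis dual to the simple roots, whose mutual angles are not acute. Determinants are never
  computed: a constant factor common to all densities leaves the inequality by homogeneity.\<close>

lemma emeasure_lborel_affine_vimage:
  fixes A :: "real set"
  assumes [measurable]: "A \<in> sets borel" and "c \<noteq> 0"
  shows "emeasure lborel {z. (z - d) / c \<in> A} = ennreal \<bar>c\<bar> * emeasure lborel A"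
proof -
  have [measurable]: "{z. (z - d) / c \<in> A} \<in> sets borel"
    by measurable
  have "emeasure lborel {z. (z - d) / c \<in> A} = (\<integral>\<^sup>+z. indicator {z. (z - d) / c \<in> A} z \<partial>lborel)"
    by simp
  also have "\<dots> = ennreal \<bar>c\<bar> * (\<integral>\<^sup>+x. indicator {z. (z - d) / c \<in> A} (d + c * x) \<partial>lborel)"
    using \<open>c \<noteq> 0\<close> by (intro nn_integral_real_affine) auto
  also have "(\<lambda>x. indicator {z. (z - d) / c \<in> A} (d + c * x) :: ennreal) = indicator A"
    using \<open>c \<noteq> 0\<close> by (auto simp: indicator_def fun_eq_iff)
  finally show ?thesis by simp
qed

text \<open>The cut points range over \<open>A\<close> itself because the Brunn-Minkowski argument
  averages an endpoint of the cut with points of the other set. If \<open>A\<close> has a maximum,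
  one cut suffices; otherwise every point of \<open>A\<close> is exceeded by further points of
  \<open>A\<close>.\<close>

lemma emeasure_lborel_eq_SUP_atMost:
  fixes A :: "real set"
  assumes [measurable]: "A \<in> sets borel"
  shows "emeasure lborel A = (SUP a\<in>A. emeasure lborel (A \<inter> {..a}))"
proof (rule antisym)
  show "(SUP a\<in>A. emeasure lborel (A \<inter> {..a})) \<le> emeasure lborel A"
    by (intro SUP_least emeasure_mono) auto
  show "emeasure lborel A \<le> (SUP a\<in>A. emeasure lborel (A \<inter> {..a}))"
  proof (cases "A = {} \<or> (\<exists>m\<in>A. \<forall>x\<in>A. x \<le> m)")
    case True
    then show ?thesis
    proof
      assume "\<exists>m\<in>A. \<forall>x\<in>A. x \<le> m"
      then obtain m where "m \<in> A" "\<forall>x\<in>A. x \<le> m" by blast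
      then have "A \<inter> {..m} = A" by auto
      then show ?thesis using \<open>m \<in> A\<close> by (intro SUP_upper2[of m]) auto
    qed auto
  next
    case False
    \<comment> \<open>\<open>r\<close> increases to the supremum of \<open>A\<close>, or to
      infinity, and each \<open>r n\<close> is exceeded by a member of \<open>A\<close>. So the cuts
      at \<open>r n\<close> exhaust \<open>A\<close>, and each is contained in a cut at a
      member.\<close>
    define r where "r n = (if bdd_above A then Sup A - 1 / Suc n else real n)" for n
    have r: "\<exists>a\<in>A. r n < a" for n
    proof (cases "bdd_above A")
      case True
      then show ?thesis using False less_cSup_iff[of A "r n"] by (auto simp: r_def)
    next
      case F: False
      then show ?thesis by (auto simp: r_def bdd_above_def not_le)
    qed
    have "incseq r"
      by (rule incseq_SucI) (auto simp: r_def field_simps)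
    then have inc: "incseq (\<lambda>n. A \<inter> {..r n})"
      by (force simp: incseq_def)
    have "\<exists>n. x \<le> r n" if "x \<in> A" for x
    proof (cases "bdd_above A")
      case True
      have "x < Sup A"
        using False that True by (metis cSup_upper less_cSup_iff empty_iff not_le)
      then obtain n where "inverse (real (Suc n)) < Sup A - x"
        using reals_Archimedean[of "Sup A - x"] by auto
      then show ?thesis using True by (intro exI[of _ n]) (auto simp: r_def inverse_eq_divide)
    next
      case F: False
      then show ?thesis using real_arch_simple[of x] by (auto simp: r_def)
    qed
    then have "A = (\<Union>n. A \<inter> {..r n})" by auto
    then have "emeasure lborel A = (SUP n. emeasure lborel (A \<inter> {..r n}))"
      using SUP_emeasure_incseq[of "\<lambda>n. A \<inter> {..r n}" lborel] inc assms
      by (metis (no_types, lifting) atMost_borel image_subset_iff sets.Int sets_lborel)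
    also have "\<dots> \<le> (SUP a\<in>A. emeasure lborel (A \<inter> {..a}))"
    proof (rule SUP_least)
      fix n
      obtain a where "a \<in> A" "r n < a" using r by blast
      then show "emeasure lborel (A \<inter> {..r n}) \<le> (SUP a\<in>A. emeasure lborel (A \<inter> {..a}))"
        by (intro SUP_upper2[of a] emeasure_mono) auto
    qed
    finally show ?thesis .
  qed
qed

lemma emeasure_lborel_eq_SUP_atLeast:
  fixes A :: "real set"
  assumes [measurable]: "A \<in> sets borel"
  shows "emeasure lborel A = (SUP a\<in>A. emeasure lborel (A \<inter> {a..}))"
proof -
  have refl: "emeasure lborel {z. - z \<in> B} = emeasure lborel B" if "B \<in> sets borel" for B :: "real set"
    using emeasure_lborel_affine_vimage[OF that, of "-1" 0] by simp
  have "emeasure lborel A = emeasure lborel {z. - z \<in> A}"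
    by (simp add: refl)
  also have "\<dots> = (SUP a\<in>{z. - z \<in> A}. emeasure lborel ({z. - z \<in> A} \<inter> {..a}))"
    by (rule emeasure_lborel_eq_SUP_atMost) measurable
  also have "\<dots> = (SUP a\<in>uminus ` A. emeasure lborel {z. - z \<in> A \<inter> {- a..}})"
    by (intro SUP_cong arg_cong[where f = "emeasure lborel"]) (auto simp: image_iff, metis minus_minus)
  also have "\<dots> = (SUP a\<in>uminus ` A. emeasure lborel (A \<inter> {- a..}))"
    by (intro SUP_cong refl) auto
  also have "\<dots> = (SUP a\<in>A. emeasure lborel (A \<inter> {a..}))"
    by (simp add: image_image)
  finally show ?thesis .
qed

text \<open>Fix \<open>a \<in> A\<close> and \<open>b \<in> B\<close>. Averaging the part of \<open>A\<close> left of \<open>a\<close> with \<open>b\<close>, and \<open>a\<close> with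
  the part of \<open>B\<close> right of \<open>b\<close>, gives two subsets of \<open>S\<close> that share at most one point.\<close>

lemma brunn_minkowski_real:
  fixes A B S :: "real set"
  assumes [measurable]: "A \<in> sets borel" "B \<in> sets borel" "S \<in> sets borel"
    and "A \<noteq> {}" "B \<noteq> {}" and t: "0 < t" "t < 1"
    and S: "\<And>x y. x \<in> A \<Longrightarrow> y \<in> B \<Longrightarrow> (1 - t) * x + t * y \<in> S"
  shows "ennreal (1 - t) * emeasure lborel A + ennreal t * emeasure lborel B \<le> emeasure lborel S"
proof -
  have *: "ennreal (1 - t) * emeasure lborel (A \<inter> {..a}) + ennreal t * emeasure lborel (B \<inter> {b..})
      \<le> emeasure lborel S" if ab: "a \<in> A" "b \<in> B" for a b
  proof -
    define A' where "A' = {z. (z - t * b) / (1 - t) \<in> A \<inter> {..a}}"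
    define B' where "B' = {z. (z - (1 - t) * a) / t \<in> B \<inter> {b..}}"
    have [measurable]: "A' \<in> sets borel" "B' \<in> sets borel"
      unfolding A'_def B'_def by measurable
    have A': "emeasure lborel A' = ennreal (1 - t) * emeasure lborel (A \<inter> {..a})"
      unfolding A'_def using t by (subst emeasure_lborel_affine_vimage) auto
    have B': "emeasure lborel B' = ennreal t * emeasure lborel (B \<inter> {b..})"
      unfolding B'_def using t by (subst emeasure_lborel_affine_vimage) auto
    have "A' \<inter> B' \<subseteq> {(1 - t) * a + t * b}"
      using t by (auto simp: A'_def B'_def field_simps)
    then have "emeasure lborel (A' \<inter> B') = 0"
      by (rule emeasure_eq_0[rotated 2]) auto
    moreover have "emeasure lborel (A' \<union> B') + emeasure lborel (A' \<inter> B') =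
        emeasure lborel A' + emeasure lborel B'"
      by (intro emeasure_Un_Int[symmetric]) auto
    ultimately have "emeasure lborel A' + emeasure lborel B' = emeasure lborel (A' \<union> B')"
      by simp
    also have "\<dots> \<le> emeasure lborel S"
    proof (intro emeasure_mono subsetI)
      fix z assume "z \<in> A' \<union> B'"
      then show "z \<in> S"
      proof
        assume "z \<in> A'"
        then show ?thesis using S[of "(z - t * b) / (1 - t)" b] ab t by (auto simp: A'_def)
      next
        assume "z \<in> B'"
        then show ?thesis using S[of a "(z - (1 - t) * a) / t"] ab t by (auto simp: B'_def)
      qed
    qed auto
    finally show ?thesis by (simp add: A' B')
  qed
  \<comment> \<open>Both index sets are nonempty, which is what allows the sums to be moved inside
    the suprema.\<close>
  have "ennreal (1 - t) * emeasure lborel A + ennreal t * emeasure lborel B =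
     (SUP b\<in>B. SUP a\<in>A. ennreal (1 - t) * emeasure lborel (A \<inter> {..a}) + ennreal t * emeasure lborel (B \<inter> {b..}))"
    using assms by (simp add: emeasure_lborel_eq_SUP_atMost[of A] emeasure_lborel_eq_SUP_atLeast[of B]
       SUP_mult_left_ennreal ennreal_SUP_add_left ennreal_SUP_add_right)
  also have "\<dots> \<le> emeasure lborel S"
    by (intro SUP_least *)
  finally show ?thesis .
qed

section \<open>The one-dimensional Prekopa-Leindler inequality\<close>

text \<open>Each value \<open>f x\<close> is the length of the set of levels \<open>s\<close> in
  (0,1) with \<open>s < f x\<close>; Fubini exchanges points and levels. Levels stay below 1 because
  the superlevel sets of the normalised functions are nonempty exactly there.\<close>

lemma nn_integral_layer_cake:
  fixes f :: "real \<Rightarrow> ennreal"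
  assumes [measurable]: "f \<in> borel_measurable borel" and f: "\<And>x. f x \<le> 1"
  shows "(\<integral>\<^sup>+x. f x \<partial>lborel) = (\<integral>\<^sup>+s\<in>{0<..<1}. emeasure lborel {x. ennreal s < f x} \<partial>lborel)"
proof -
  have *: "f x = (\<integral>\<^sup>+s. indicator {0<..<1} s * indicator {x. ennreal s < f x} x \<partial>lborel)" for x
  proof -
    obtain r where r: "f x = ennreal r" "0 \<le> r" "r \<le> 1"
      using f[of x] by (cases "f x") (auto simp: ennreal_le_1 top_unique)
    have "(\<integral>\<^sup>+s. indicator {0<..<1} s * indicator {x. ennreal s < f x} x \<partial>lborel) =
        (\<integral>\<^sup>+s. indicator {0<..<r} s \<partial>lborel)"
      using r by (intro nn_integral_cong) (auto simp: indicator_def ennreal_less_iff)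
    also have "\<dots> = f x" using r by simp
    finally show ?thesis by simp
  qed
  have "(\<integral>\<^sup>+x. f x \<partial>lborel) =
      (\<integral>\<^sup>+x. \<integral>\<^sup>+s. indicator {0<..<1} s * indicator {x. ennreal s < f x} x \<partial>lborel \<partial>lborel)"
    by (intro nn_integral_cong *)
  also have "\<dots> = (\<integral>\<^sup>+s. \<integral>\<^sup>+x. indicator {0<..<1} s * indicator {x. ennreal s < f x} x \<partial>lborel \<partial>lborel)"
    by (intro lborel_pair.Fubini') measurable
  also have "\<dots> = (\<integral>\<^sup>+s\<in>{0<..<1}. emeasure lborel {x. ennreal s < f x} \<partial>lborel)"
    by (intro nn_integral_cong) (subst nn_integral_cmult, auto simp: mult.commute[of "indicator _ _"])
  finally show ?thesis .
qed

text \<open>Suprema equal to 1 make the superlevel sets of \<open>f\<close> and \<open>g\<close>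
  nonempty at every level below 1, so Brunn-Minkowski applies level by level. This gives an
  arithmetic mean of the integrals, which is more than the geometric mean.\<close>

lemma prekopa_leindler_real_normalized:
  fixes f g h :: "real \<Rightarrow> ennreal"
  assumes [measurable]: "f \<in> borel_measurable borel" "g \<in> borel_measurable borel" "h \<in> borel_measurable borel"
    and t: "0 < t" "t < 1"
    and f: "\<And>x. f x \<le> 1" "\<And>s. s < 1 \<Longrightarrow> \<exists>x. ennreal s < f x"
    and g: "\<And>x. g x \<le> 1" "\<And>s. s < 1 \<Longrightarrow> \<exists>x. ennreal s < g x"
    and h: "\<And>x y s. 0 < s \<Longrightarrow> s < 1 \<Longrightarrow> ennreal s < f x \<Longrightarrow> ennreal s < g y \<Longrightarrow> ennreal s < h ((1 - t) * x + t * y)"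
  shows "ennreal (1 - t) * (\<integral>\<^sup>+x. f x \<partial>lborel) + ennreal t * (\<integral>\<^sup>+x. g x \<partial>lborel) \<le> (\<integral>\<^sup>+x. h x \<partial>lborel)"
proof -
  let ?D = "\<lambda>f s. emeasure lborel {x. ennreal s < f x} * indicator {0<..<1} s"
  have "ennreal (1 - t) * (\<integral>\<^sup>+x. f x \<partial>lborel) + ennreal t * (\<integral>\<^sup>+x. g x \<partial>lborel) =
     (\<integral>\<^sup>+s. ennreal (1 - t) * ?D f s + ennreal t * ?D g s \<partial>lborel)"
    by (simp add: nn_integral_layer_cake f(1) g(1) nn_integral_add nn_integral_cmult)
  \<comment> \<open>\<open>h\<close> is cut off at 1 because the layer cake formula is stated for
    functions bounded by 1; levels below 1 do not see the cut.\<close>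
  also have "\<dots> \<le> (\<integral>\<^sup>+s. ?D (\<lambda>x. min (h x) 1) s \<partial>lborel)"
  proof (intro nn_integral_mono)
    fix s :: real
    show "ennreal (1 - t) * ?D f s + ennreal t * ?D g s \<le> ?D (\<lambda>x. min (h x) 1) s"
    proof (cases "s \<in> {0<..<1}")
      case True
      have "ennreal (1 - t) * emeasure lborel {x. ennreal s < f x} + ennreal t * emeasure lborel {x. ennreal s < g x}
         \<le> emeasure lborel {x. ennreal s < min (h x) 1}"
        using f(2)[of s] g(2)[of s] True h t
        by (intro brunn_minkowski_real) (auto simp: ennreal_less_one_iff)
      then show ?thesis using True by simp
    qed simp
  qed
  also have "\<dots> = (\<integral>\<^sup>+x. min (h x) 1 \<partial>lborel)"
    by (rule nn_integral_layer_cake[symmetric]) auto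
  also have "\<dots> \<le> (\<integral>\<^sup>+x. h x \<partial>lborel)"
    by (intro nn_integral_mono) auto
  finally show ?thesis .
qed

lemma weighted_am_gm:
  fixes a b :: real
  assumes "0 < a" "0 < b" "0 < t" "t < 1"
  shows "a powr (1 - t) * b powr t \<le> (1 - t) * a + t * b"
  using Youngs_inequality_0[of "1 - t" t a b] assms by simp

text \<open>Common factors leave the inequality through this homogeneity: shrinking factors, the
  Jacobian and Gaussian constants, and finally the number of chambers.\<close>

lemma powr_mult_scale:
  fixes r :: real
  assumes "0 < r"
  shows "(r * p) powr (1 - t) * (r * q) powr t = r * (p powr (1 - t) * q powr t)"
proof -
  have "r powr (1 - t) * r powr t = r"
    using assms by (simp flip: powr_add)
  then show ?thesis
    using assms by (simp add: powr_mult algebra_simps)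
qed

text \<open>\<open>powr\<close> acts on reals whereas the integrals lie in \<open>ennreal\<close>,
  so hypotheses and conclusion speak of positive real lower bounds \<open>p\<close> and
  \<open>q\<close>. Dividing \<open>f\<close> and \<open>g\<close> by their suprema \<open>a\<close>
  and \<open>b\<close>, and \<open>h\<close> by the geometric mean \<open>c\<close> of these, gives
  the normalised case; AM-GM for \<open>p / a\<close> and \<open>q / b\<close> then returns to the
  geometric mean.\<close>

lemma prekopa_leindler_real_bounded:
  fixes f g h :: "real \<Rightarrow> ennreal"
  assumes [measurable]: "f \<in> borel_measurable borel" "g \<in> borel_measurable borel" "h \<in> borel_measurable borel"
    and t: "0 < t" "t < 1"
    and f: "\<And>x. f x \<le> ennreal k" and g: "\<And>x. g x \<le> ennreal k"
    and h: "\<And>x y p q. 0 < p \<Longrightarrow> 0 < q \<Longrightarrow> ennreal p \<le> f x \<Longrightarrow> ennreal q \<le> g y \<Longrightarrow>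
      ennreal (p powr (1 - t) * q powr t) \<le> h ((1 - t) * x + t * y)"
    and p: "0 < p" "ennreal p \<le> (\<integral>\<^sup>+x. f x \<partial>lborel)"
    and q: "0 < q" "ennreal q \<le> (\<integral>\<^sup>+x. g x \<partial>lborel)"
  shows "ennreal (p powr (1 - t) * q powr t) \<le> (\<integral>\<^sup>+x. h x \<partial>lborel)"
proof -
  have sup: "\<exists>a>0. (SUP x. f x) = ennreal a"
    if f: "\<And>x. f x \<le> ennreal k" and p: "0 < p" "ennreal p \<le> (\<integral>\<^sup>+x. f x \<partial>lborel)" for f :: "real \<Rightarrow> ennreal" and p
  proof -
    have "(SUP x. f x) \<le> ennreal k" by (intro SUP_least f)
    then obtain a where a: "(SUP x. f x) = ennreal a" "0 \<le> a"
      by (cases "SUP x. f x") (auto simp: top_unique)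
    have "a \<noteq> 0"
    proof
      assume "a = 0"
      then have "f x \<le> 0" for x
        using SUP_upper[of x UNIV f] a by simp
      then show False using p by simp
    qed
    then show ?thesis using a by (intro exI[of _ a]) auto
  qed
  obtain a where a: "0 < a" "(SUP x. f x) = ennreal a" using sup[OF f p] by blast
  obtain b where b: "0 < b" "(SUP x. g x) = ennreal b" using sup[OF g q] by blast
  define c where "c = a powr (1 - t) * b powr t"
  have c: "0 < c" using a b by (simp add: c_def)
  have norm: "f x / ennreal a \<le> 1" "s < 1 \<Longrightarrow> \<exists>x. ennreal s < f x / ennreal a"
    "ennreal s < f x / ennreal a \<Longrightarrow> 0 < s \<Longrightarrow> \<exists>p>s * a. ennreal p \<le> f x"
    if a: "0 < a" "(SUP x. f x) = ennreal a" for f :: "real \<Rightarrow> ennreal" and a x s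
  proof -
    have le: "f x \<le> ennreal a" for x
      using SUP_upper[of x UNIV f] a by simp
    have fin: "\<exists>r\<ge>0. f x = ennreal r" for x
      using le[of x] by (cases "f x") (auto simp: top_unique)
    show "f x / ennreal a \<le> 1"
      using le[of x] fin[of x] a by (auto simp: divide_ennreal ennreal_le_1)
    show "\<exists>x. ennreal s < f x / ennreal a" if s: "s < 1"
    proof -
      have "ennreal (max s 0 * a) < (SUP x. f x)"
        using a s by (auto simp: ennreal_less_iff max_def)
      then obtain x where x: "ennreal (max s 0 * a) < f x" by (auto simp: less_SUP_iff)
      obtain r where r: "r \<ge> 0" "f x = ennreal r" using fin by blast
      have "max s 0 * a < r" using x r a by (simp add: ennreal_less_iff)
      then have "ennreal (max s 0) < f x / ennreal a"
        using r a by (auto simp: divide_ennreal ennreal_less_iff field_simps max_def split: if_splits)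
      then show ?thesis
        by (intro exI[of _ x]) (metis ennreal_leI max.cobounded1 le_less_trans)
    qed
    show "\<exists>p>s * a. ennreal p \<le> f x" if "ennreal s < f x / ennreal a" "0 < s"
    proof -
      obtain r where r: "r \<ge> 0" "f x = ennreal r" using fin by blast
      show ?thesis
        using that r a by (intro exI[of _ r]) (auto simp: divide_ennreal ennreal_less_iff field_simps)
    qed
  qed
  have "ennreal (1 - t) * (\<integral>\<^sup>+x. f x / ennreal a \<partial>lborel) + ennreal t * (\<integral>\<^sup>+x. g x / ennreal b \<partial>lborel)
      \<le> (\<integral>\<^sup>+x. h x / ennreal c \<partial>lborel)"
  proof (intro prekopa_leindler_real_normalized norm(1,2)[OF a] norm(1,2)[OF b] t)
    fix x y s :: real
    assume s: "0 < s" "s < 1" "ennreal s < f x / ennreal a" "ennreal s < g y / ennreal b"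
    obtain p where p: "s * a < p" "ennreal p \<le> f x" using norm(3)[OF a] s by blast
    obtain q where q: "s * b < q" "ennreal q \<le> g y" using norm(3)[OF b] s by blast
    have "0 < s * a" "0 < s * b" using a b s by auto
    then have "(s * a) powr (1 - t) * (s * b) powr t < p powr (1 - t) * q powr t"
      using p q t by (intro mult_strict_mono powr_less_mono2) auto
    then have "s * c < p powr (1 - t) * q powr t"
      using s by (simp add: powr_mult_scale c_def)
    then have "ennreal (s * c) < ennreal (p powr (1 - t) * q powr t)"
      using s c by (simp add: ennreal_less_iff)
    also have "\<dots> \<le> h ((1 - t) * x + t * y)"
      using \<open>0 < s * a\<close> \<open>0 < s * b\<close> p q by (intro h) auto
    finally have "ennreal s * ennreal c < h ((1 - t) * x + t * y)"
      using s c by (simp add: ennreal_mult)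
    then show "ennreal s < h ((1 - t) * x + t * y) / ennreal c"
      using c by (cases "h ((1 - t) * x + t * y)")
        (use s in \<open>auto simp: divide_ennreal ennreal_less_iff pos_less_divide_eq ennreal_top_divide simp flip: ennreal_mult''\<close>)
  qed auto
  then have *: "ennreal (1 - t) * ((\<integral>\<^sup>+x. f x \<partial>lborel) / ennreal a) + ennreal t * ((\<integral>\<^sup>+x. g x \<partial>lborel) / ennreal b)
      \<le> (\<integral>\<^sup>+x. h x \<partial>lborel) / ennreal c"
    by (simp add: nn_integral_divide)
  have "p powr (1 - t) * q powr t = c * ((p / a) powr (1 - t) * (q / b) powr t)"
    using a b p q by (simp add: c_def powr_divide)
  also have "\<dots> \<le> c * ((1 - t) * (p / a) + t * (q / b))"
    using a b p q t c by (intro mult_left_mono weighted_am_gm) auto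
  finally have "ennreal (p powr (1 - t) * q powr t) \<le> ennreal (c * ((1 - t) * (p / a) + t * (q / b)))"
    by (intro ennreal_leI)
  also have "\<dots> = ennreal c * (ennreal (1 - t) * (ennreal p / ennreal a) + ennreal t * (ennreal q / ennreal b))"
    using a b c p q t by (simp add: ennreal_mult ennreal_plus divide_ennreal del: times_divide_eq_right)
  also have "\<dots> \<le> ennreal c * (ennreal (1 - t) * ((\<integral>\<^sup>+x. f x \<partial>lborel) / ennreal a) + ennreal t * ((\<integral>\<^sup>+x. g x \<partial>lborel) / ennreal b))"
    by (intro mult_left_mono add_mono divide_right_mono_ennreal p q) auto
  also have "\<dots> \<le> ennreal c * ((\<integral>\<^sup>+x. h x \<partial>lborel) / ennreal c)"
    by (intro mult_left_mono *) auto
  also have "\<dots> = (\<integral>\<^sup>+x. h x \<partial>lborel)"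
    using c by (subst ennreal_times_divide, subst mult.commute, intro mult_divide_eq_ennreal) auto
  finally show ?thesis .
qed

lemma nn_integral_truncation_greater:
  assumes [measurable]: "f \<in> borel_measurable M" and p: "p < (\<integral>\<^sup>+x. f x \<partial>M)"
  shows "\<exists>k::nat. p < (\<integral>\<^sup>+x. min (f x) (of_nat k) \<partial>M)"
proof -
  have *: "(SUP k::nat. min (f x) (of_nat k)) = f x" for x
  proof -
    have "(SUP k::nat. min (f x) (of_nat k)) = min (f x) (SUP k::nat. of_nat k)"
      by (simp add: inf_min[symmetric] inf_SUP)
    then show ?thesis by (simp add: ennreal_SUP_of_nat_eq_top)
  qed
  have "(\<integral>\<^sup>+x. f x \<partial>M) = (\<integral>\<^sup>+x. (SUP k::nat. min (f x) (of_nat k)) \<partial>M)"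
    by (simp add: *)
  also have "\<dots> = (SUP k::nat. \<integral>\<^sup>+x. min (f x) (of_nat k) \<partial>M)"
    by (intro nn_integral_monotone_convergence_SUP)
      (auto simp: incseq_def le_fun_def min_def intro: order_trans)
  finally show ?thesis using p by (simp add: less_SUP_iff)
qed

text \<open>Truncations of \<open>f\<close> and \<open>g\<close> inherit the hypothesis on
  \<open>h\<close>, since a lower bound of a truncation is one of the function itself. Truncating
  costs a little of each integral, so the bounds are first shrunk by a factor \<open>r < 1\<close>,
  which may be taken as close to 1 as desired.\<close>

lemma prekopa_leindler_real:
  fixes f g h :: "real \<Rightarrow> ennreal"
  assumes [measurable]: "f \<in> borel_measurable borel" "g \<in> borel_measurable borel" "h \<in> borel_measurable borel"
    and t: "0 < t" "t < 1"
    and h: "\<And>x y p q. 0 < p \<Longrightarrow> 0 < q \<Longrightarrow> ennreal p \<le> f x \<Longrightarrow> ennreal q \<le> g y \<Longrightarrow>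
      ennreal (p powr (1 - t) * q powr t) \<le> h ((1 - t) * x + t * y)"
    and p: "0 < p" "ennreal p \<le> (\<integral>\<^sup>+x. f x \<partial>lborel)"
    and q: "0 < q" "ennreal q \<le> (\<integral>\<^sup>+x. g x \<partial>lborel)"
  shows "ennreal (p powr (1 - t) * q powr t) \<le> (\<integral>\<^sup>+x. h x \<partial>lborel)"
proof (rule ccontr)
  define d where "d = p powr (1 - t) * q powr t"
  have "0 < d" using p q by (simp add: d_def)
  have *: "ennreal (r * d) \<le> (\<integral>\<^sup>+x. h x \<partial>lborel)" if r: "0 < r" "r < 1" for r
  proof -
    have "ennreal (r * p) < (\<integral>\<^sup>+x. f x \<partial>lborel)" "ennreal (r * q) < (\<integral>\<^sup>+x. g x \<partial>lborel)"
      using r p q by (auto intro!: less_le_trans[OF _ p(2)] less_le_trans[OF _ q(2)] simp: ennreal_less_iff)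
    then obtain k l :: nat where kl: "ennreal (r * p) < (\<integral>\<^sup>+x. min (f x) (of_nat k) \<partial>lborel)"
        "ennreal (r * q) < (\<integral>\<^sup>+x. min (g x) (of_nat l) \<partial>lborel)"
      using nn_integral_truncation_greater[of f lborel] nn_integral_truncation_greater[of g lborel]
      by (metis assms(1,2) measurable_lborel2)
    have "ennreal ((r * p) powr (1 - t) * (r * q) powr t) \<le> (\<integral>\<^sup>+x. h x \<partial>lborel)"
    proof (rule prekopa_leindler_real_bounded[of "\<lambda>x. min (f x) (of_nat k)" "\<lambda>x. min (g x) (of_nat l)" h t "real (max k l)"])
      show "min (f x) (of_nat k) \<le> ennreal (real (max k l))" for x
        by (intro min.coboundedI2) (simp add: ennreal_of_nat_eq_real_of_nat ennreal_leI)
      show "min (g x) (of_nat l) \<le> ennreal (real (max k l))" for x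
        by (intro min.coboundedI2) (simp add: ennreal_of_nat_eq_real_of_nat ennreal_leI)
    qed (use r p q t kl h in \<open>auto intro: less_imp_le\<close>)
    then show ?thesis using r by (simp add: powr_mult_scale d_def)
  qed
  assume "\<not> ?thesis"
  then have less: "(\<integral>\<^sup>+x. h x \<partial>lborel) < ennreal d" by (simp add: d_def)
  then obtain m where m: "(\<integral>\<^sup>+x. h x \<partial>lborel) = ennreal m" "0 \<le> m" "m < d"
    by (cases "\<integral>\<^sup>+x. h x \<partial>lborel") (auto simp: ennreal_less_iff)
  \<comment> \<open>Chosen so that \<open>r * d\<close> is the midpoint of \<open>m\<close> and
    \<open>d\<close>, which exceeds the integral \<open>m\<close>.\<close>
  define r where "r = (m + d) / (2 * d)"
  have r: "0 < r" "r < 1" using m \<open>0 < d\<close> by (auto simp: r_def field_simps)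
  have "r * d = (m + d) / 2" using \<open>0 < d\<close> by (simp add: r_def)
  then show False using *[OF r] m by (simp add: ennreal_le_iff)
qed

section \<open>Exponential coordinates and induction on the dimension\<close>

text \<open>The substitution rule for compact intervals is applied to \<open>A k\<close> and its
  image \<open>B k\<close> under \<open>exp\<close>. These grow to the line and to the positive
  half-line, and continuity of density measures along increasing unions passes to the limit.\<close>

lemma nn_integral_exp_substitution:
  fixes f :: "real \<Rightarrow> ennreal"
  assumes [measurable]: "f \<in> borel_measurable borel"
  shows "(\<integral>\<^sup>+x\<in>{0<..}. f x \<partial>lborel) = (\<integral>\<^sup>+s. f (exp s) * ennreal (exp s) \<partial>lborel)"
proof -
  have SUP_int: "(\<integral>\<^sup>+x. F x * indicator (\<Union>k. A k) x \<partial>lborel) = (SUP k. \<integral>\<^sup>+x. F x * indicator (A k) x \<partial>lborel)"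
    if "incseq A" "F \<in> borel_measurable borel" "\<And>k. A k \<in> sets borel" for F :: "real \<Rightarrow> ennreal" and A :: "nat \<Rightarrow> real set"
    using that SUP_emeasure_incseq[of A "density lborel F"] by (auto simp: emeasure_density image_subset_iff)
  \<comment> \<open>\<open>Suc k\<close> gives intervals of positive length already for
    \<open>k = 0\<close>.\<close>
  define A where "A k = {- real (Suc k) .. real (Suc k)}" for k
  define B where "B k = {exp (- real (Suc k)) .. exp (real (Suc k))}" for k
  have inc: "incseq A" "incseq B" by (auto simp: A_def B_def incseq_def) 
  have UA: "(\<Union>k. A k) = UNIV"
  proof -
    have "\<exists>k. x \<in> A k" for x
    proof -
      obtain k :: nat where "\<bar>x\<bar> \<le> real k" using real_arch_simple by blast
      then show ?thesis by (intro exI[of _ k]) (auto simp: A_def)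
    qed
    then show ?thesis by auto
  qed
  have UB: "(\<Union>k. B k) = {0<..}"
  proof -
    have "x \<in> B k \<longleftrightarrow> 0 < x \<and> ln x \<in> A k" for x k
      by (smt (verit) A_def B_def atLeastAtMost_iff exp_gt_zero exp_le_cancel_iff exp_ln)
    then show ?thesis using UA by (auto simp: set_eq_iff)
  qed
  have "(\<integral>\<^sup>+x\<in>B k. f x \<partial>lborel) = (\<integral>\<^sup>+s\<in>A k. f (exp s) * ennreal (exp s) \<partial>lborel)" for k
    unfolding A_def B_def
    by (rule nn_integral_substitution_aux) (auto intro!: derivative_eq_intros continuous_intros)
  then show ?thesis
    using SUP_int[OF inc(2), of f] SUP_int[OF inc(1), of "\<lambda>s. f (exp s) * ennreal (exp s)"]
    by (simp add: UA UB) (simp add: A_def B_def)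
qed

text \<open>Under \<open>x = exp s\<close> a geometric mean of arguments becomes an arithmetic mean
  of exponents. The Jacobian \<open>exp s\<close> is log-linear, so
  \<open>f (exp s) * ennreal (exp s)\<close> and its analogues satisfy the additive
  hypothesis.\<close>

lemma prekopa_leindler_real_multiplicative:
  fixes f g h :: "real \<Rightarrow> ennreal"
  assumes [measurable]: "f \<in> borel_measurable borel" "g \<in> borel_measurable borel" "h \<in> borel_measurable borel"
    and t: "0 < t" "t < 1"
    and f: "\<And>x. f x \<noteq> 0 \<Longrightarrow> 0 < x" and g: "\<And>x. g x \<noteq> 0 \<Longrightarrow> 0 < x"
    and h: "\<And>x y p q. 0 < p \<Longrightarrow> 0 < q \<Longrightarrow> ennreal p \<le> f x \<Longrightarrow> ennreal q \<le> g y \<Longrightarrow>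
      ennreal (p powr (1 - t) * q powr t) \<le> h (x powr (1 - t) * y powr t)"
    and p: "0 < p" "ennreal p \<le> (\<integral>\<^sup>+x. f x \<partial>lborel)"
    and q: "0 < q" "ennreal q \<le> (\<integral>\<^sup>+x. g x \<partial>lborel)"
  shows "ennreal (p powr (1 - t) * q powr t) \<le> (\<integral>\<^sup>+x. h x \<partial>lborel)"
proof -
  have sub: "(\<integral>\<^sup>+x. f x \<partial>lborel) = (\<integral>\<^sup>+s. f (exp s) * ennreal (exp s) \<partial>lborel)"
    if [measurable]: "f \<in> borel_measurable borel" and f: "\<And>x. f x \<noteq> 0 \<Longrightarrow> 0 < x" for f :: "real \<Rightarrow> ennreal"
  proof -
    have "(\<integral>\<^sup>+x. f x \<partial>lborel) = (\<integral>\<^sup>+x\<in>{0<..}. f x \<partial>lborel)"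
      using f by (intro nn_integral_cong) (auto simp: indicator_def)
    then show ?thesis by (simp add: nn_integral_exp_substitution)
  qed
  have "ennreal (p powr (1 - t) * q powr t) \<le> (\<integral>\<^sup>+s. h (exp s) * ennreal (exp s) \<partial>lborel)"
  proof (rule prekopa_leindler_real[OF _ _ _ t, of "\<lambda>s. f (exp s) * ennreal (exp s)" "\<lambda>s. g (exp s) * ennreal (exp s)"])
    fix x y p q :: real
    assume p: "0 < p" "ennreal p \<le> f (exp x) * ennreal (exp x)"
      and q: "0 < q" "ennreal q \<le> g (exp y) * ennreal (exp y)"
    have shift: "ennreal (p / exp x) \<le> f (exp x)"
      if "ennreal p \<le> f (exp x) * ennreal (exp x)" "0 < p" for f :: "real \<Rightarrow> ennreal" and p x
      using that by (cases "f (exp x)") (auto simp: ennreal_le_iff field_simps simp flip: ennreal_mult'')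
    have e: "exp x powr (1 - t) * exp y powr t = exp ((1 - t) * x + t * y)"
      by (simp add: powr_def exp_add)
    have "p powr (1 - t) * q powr t =
        ((p / exp x) powr (1 - t) * (q / exp y) powr t) * exp ((1 - t) * x + t * y)"
      using p q by (simp add: powr_divide flip: e)
    also have "ennreal \<dots> = ennreal ((p / exp x) powr (1 - t) * (q / exp y) powr t) * ennreal (exp ((1 - t) * x + t * y))"
      by (simp add: ennreal_mult)
    also have "\<dots> \<le> h (exp x powr (1 - t) * exp y powr t) * ennreal (exp ((1 - t) * x + t * y))"
      using p q by (intro mult_right_mono h shift) auto
    finally show "ennreal (p powr (1 - t) * q powr t) \<le> h (exp ((1 - t) * x + t * y)) * ennreal (exp ((1 - t) * x + t * y))"
      by (simp only: e)
  qed (use p q f g in \<open>auto simp flip: sub\<close>)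
  also have "\<dots> = (\<integral>\<^sup>+x\<in>{0<..}. h x \<partial>lborel)"
    by (simp add: nn_integral_exp_substitution)
  also have "\<dots> \<le> (\<integral>\<^sup>+x. h x \<partial>lborel)"
    by (intro nn_integral_mono) (auto simp: indicator_def)
  finally show ?thesis .
qed

text \<open>Fix coordinate \<open>i\<close> and integrate over the others: the induction hypothesis
  for two slices is precisely the hypothesis that the one-dimensional inequality makes on the
  marginals. The two match because hypothesis and conclusion both use real lower bounds.\<close>

lemma prekopa_leindler_PiM_multiplicative:
  fixes f g h :: "('i \<Rightarrow> real) \<Rightarrow> ennreal"
  assumes "finite I" and t: "0 < t" "t < 1"
    and "f \<in> borel_measurable (Pi\<^sub>M I (\<lambda>_. lborel))" "g \<in> borel_measurable (Pi\<^sub>M I (\<lambda>_. lborel))"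
      "h \<in> borel_measurable (Pi\<^sub>M I (\<lambda>_. lborel))"
    and "\<And>x i. f x \<noteq> 0 \<Longrightarrow> i \<in> I \<Longrightarrow> 0 < x i" "\<And>x i. g x \<noteq> 0 \<Longrightarrow> i \<in> I \<Longrightarrow> 0 < x i"
    and "\<And>x y p q. 0 < p \<Longrightarrow> 0 < q \<Longrightarrow> ennreal p \<le> f x \<Longrightarrow> ennreal q \<le> g y \<Longrightarrow>
      ennreal (p powr (1 - t) * q powr t) \<le> h (\<lambda>i\<in>I. x i powr (1 - t) * y i powr t)"
    and "0 < p" "ennreal p \<le> (\<integral>\<^sup>+x. f x \<partial>Pi\<^sub>M I (\<lambda>_. lborel))"
    and "0 < q" "ennreal q \<le> (\<integral>\<^sup>+x. g x \<partial>Pi\<^sub>M I (\<lambda>_. lborel))"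
  shows "ennreal (p powr (1 - t) * q powr t) \<le> (\<integral>\<^sup>+x. h x \<partial>Pi\<^sub>M I (\<lambda>_. lborel))"
  using assms(1,4-)
proof (induction I arbitrary: f g h p q rule: finite_induct)
  case empty
  \<comment> \<open>The product over no coordinates is a point mass, so each integral is the value
    at the function that is \<open>undefined\<close> everywhere.\<close>
  then show ?case
    using empty(6)[of p q "\<lambda>_. undefined" "\<lambda>_. undefined"]
    by (simp add: PiM_empty nn_integral_count_space_finite)
next
  case (insert i I)
  interpret product_sigma_finite "\<lambda>_::'i. lborel :: real measure"
    by (simp add: product_sigma_finite_def sigma_finite_lborel)
  have sect: "(\<lambda>x. F (x(i := s))) \<in> borel_measurable (Pi\<^sub>M I (\<lambda>_. lborel))"
    if "F \<in> borel_measurable (Pi\<^sub>M (insert i I) (\<lambda>_. lborel))" for F :: "('i \<Rightarrow> real) \<Rightarrow> ennreal" and s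
    by (rule measurable_compose[OF _ that], rule measurable_fun_upd[where J = I]) auto
  have meas: "(\<lambda>s. \<integral>\<^sup>+x. F (x(i := s)) \<partial>Pi\<^sub>M I (\<lambda>_. lborel)) \<in> borel_measurable borel"
    if [measurable]: "F \<in> borel_measurable (Pi\<^sub>M (insert i I) (\<lambda>_. lborel))" for F :: "('i \<Rightarrow> real) \<Rightarrow> ennreal"
  proof -
    interpret I: finite_product_sigma_finite "\<lambda>_::'i. lborel :: real measure" I
      using insert by unfold_locales auto
    have "(\<lambda>(s, x). F (x(i := s))) \<in> borel_measurable (lborel \<Otimes>\<^sub>M Pi\<^sub>M I (\<lambda>_. lborel))"
      unfolding case_prod_beta
      by (rule measurable_compose[OF _ that], rule measurable_fun_upd[where J = I]) auto
    then show ?thesis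
      using I.borel_measurable_nn_integral[of "\<lambda>s x. F (x(i := s))" lborel] by simp
  qed
  let ?M = "\<lambda>F s. \<integral>\<^sup>+x. F (x(i := s)) \<partial>Pi\<^sub>M I (\<lambda>_. lborel)"
  have fubini: "(\<integral>\<^sup>+x. F x \<partial>Pi\<^sub>M (insert i I) (\<lambda>_. lborel)) = (\<integral>\<^sup>+s. ?M F s \<partial>lborel)"
    if "F \<in> borel_measurable (Pi\<^sub>M (insert i I) (\<lambda>_. lborel))" for F :: "('i \<Rightarrow> real) \<Rightarrow> ennreal"
    using insert that by (intro product_nn_integral_insert_rev) auto
  have supp: "0 < s" if "?M F s \<noteq> 0" "\<And>x j. F x \<noteq> 0 \<Longrightarrow> j \<in> insert i I \<Longrightarrow> 0 < x j"
    for F :: "('i \<Rightarrow> real) \<Rightarrow> ennreal" and s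
  proof (rule ccontr)
    assume "\<not> 0 < s"
    then have "F (x(i := s)) = 0" for x
      using that(2)[of "x(i := s)" i] by auto
    then show False using that(1) by simp
  qed
  show ?case
    unfolding fubini[OF insert.prems(3)]
  proof (rule prekopa_leindler_real_multiplicative[OF _ _ _ t, of "?M f" "?M g"])
    fix a b p q :: real
    assume pq: "0 < p" "0 < q" "ennreal p \<le> ?M f a" "ennreal q \<le> ?M g b"
    show "ennreal (p powr (1 - t) * q powr t) \<le> ?M h (a powr (1 - t) * b powr t)"
    proof (rule insert.IH[of "\<lambda>x. f (x(i := a))" "\<lambda>x. g (x(i := b))"])
      fix x j
      assume "f (x(i := a)) \<noteq> 0" "j \<in> I"
      then show "0 < x j" using insert.prems(4)[of "x(i := a)" j] insert.hyps by (metis fun_upd_other insertI2)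
    next
      fix x j
      assume "g (x(i := b)) \<noteq> 0" "j \<in> I"
      then show "0 < x j" using insert.prems(5)[of "x(i := b)" j] insert.hyps by (metis fun_upd_other insertI2)
    next
      fix x y p q
      assume "0 < p" "0 < q" "ennreal p \<le> f (x(i := a))" "ennreal q \<le> g (y(i := b))"
      then have "ennreal (p powr (1 - t) * q powr t) \<le>
          h (\<lambda>j\<in>insert i I. (x(i := a)) j powr (1 - t) * (y(i := b)) j powr t)"
        by (rule insert.prems(6))
      also have "(\<lambda>j\<in>insert i I. (x(i := a)) j powr (1 - t) * (y(i := b)) j powr t) =
          (\<lambda>j\<in>I. x j powr (1 - t) * y j powr t)(i := a powr (1 - t) * b powr t)"
        using insert.hyps by (auto simp: fun_eq_iff)
      finally show "ennreal (p powr (1 - t) * q powr t) \<le>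
          h ((\<lambda>j\<in>I. x j powr (1 - t) * y j powr t)(i := a powr (1 - t) * b powr t))" .
    qed (use insert.prems pq in \<open>auto intro: sect simp del: fun_upd_apply\<close>)
  qed (use insert.prems meas supp fubini in auto)
qed

lemma prekopa_leindler_orthant:
  fixes f g h :: "'a::euclidean_space \<Rightarrow> ennreal"
  assumes t: "0 < t" "t < 1"
    and [measurable]: "f \<in> borel_measurable borel" "g \<in> borel_measurable borel" "h \<in> borel_measurable borel"
    and supp: "\<And>x b. f x \<noteq> 0 \<Longrightarrow> b \<in> Basis \<Longrightarrow> 0 < x \<bullet> b" "\<And>x b. g x \<noteq> 0 \<Longrightarrow> b \<in> Basis \<Longrightarrow> 0 < x \<bullet> b"
    and h: "\<And>x y p q. 0 < p \<Longrightarrow> 0 < q \<Longrightarrow> ennreal p \<le> f x \<Longrightarrow> ennreal q \<le> g y \<Longrightarrow>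
      ennreal (p powr (1 - t) * q powr t) \<le> h (\<Sum>b\<in>Basis. ((x \<bullet> b) powr (1 - t) * (y \<bullet> b) powr t) *\<^sub>R b)"
    and p: "0 < p" "ennreal p \<le> (\<integral>\<^sup>+x. f x \<partial>lborel)"
    and q: "0 < q" "ennreal q \<le> (\<integral>\<^sup>+x. g x \<partial>lborel)"
  shows "ennreal (p powr (1 - t) * q powr t) \<le> (\<integral>\<^sup>+x. h x \<partial>lborel)"
proof -
  let ?v = "\<lambda>x. \<Sum>b\<in>Basis. x b *\<^sub>R b :: 'a"
  have int: "(\<integral>\<^sup>+x. F x \<partial>lborel) = (\<integral>\<^sup>+x. F (?v x) \<partial>Pi\<^sub>M Basis (\<lambda>_. lborel))"
    if [measurable]: "F \<in> borel_measurable borel" for F :: "'a \<Rightarrow> ennreal"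
    by (subst lborel_eq, subst nn_integral_distr) auto
  have coord: "?v x \<bullet> b = x b" if "b \<in> Basis" for x b
    using that by simp
  show ?thesis
    unfolding int[OF assms(5)]
  proof (rule prekopa_leindler_PiM_multiplicative[OF finite_Basis t, of "\<lambda>x. f (?v x)" "\<lambda>x. g (?v x)"])
    fix x y p q
    assume "0 < p" "0 < q" "ennreal p \<le> f (?v x)" "ennreal q \<le> g (?v y)"
    from h[OF this] show "ennreal (p powr (1 - t) * q powr t) \<le>
       h (?v (\<lambda>i\<in>Basis. x i powr (1 - t) * y i powr t))"
      by (simp add: coord cong: sum.cong)
  qed (use supp[of "?v _"] p q in \<open>auto simp: coord int[symmetric]\<close>)
qed

section \<open>Linear changes of variables\<close>

text \<open>Integrating \<open>F (T x) * indicator U (y + T x)\<close> over all \<open>(x, y)\<close> in both orders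
  replaces the determinant: the factor is read off a single set \<open>U\<close>.\<close>

lemma nn_integral_linear_substitution:
  fixes T :: "'a::euclidean_space \<Rightarrow> 'a" and F :: "'a \<Rightarrow> ennreal"
  assumes T: "linear T" "bij T" and [measurable]: "F \<in> borel_measurable borel" "U \<in> sets borel"
  shows "emeasure lborel U * (\<integral>\<^sup>+x. F (T x) \<partial>lborel) = emeasure lborel (T -` U) * (\<integral>\<^sup>+x. F x \<partial>lborel)"
proof -
  interpret lborel_pair: pair_sigma_finite "lborel :: 'a measure" "lborel :: 'a measure" ..
  have [measurable]: "T \<in> borel_measurable borel"
    using T by (intro borel_measurable_continuous_onI linear_continuous_on linear_conv_bounded_linear[THEN iffD1])
  have shift: "(\<integral>\<^sup>+x. G x \<partial>lborel) = (\<integral>\<^sup>+x. G (c + x) \<partial>lborel)"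
    if [measurable]: "G \<in> borel_measurable borel" for G :: "'a \<Rightarrow> ennreal" and c
    by (subst lborel_distr_plus[of c, symmetric], subst nn_integral_distr) (auto simp: add.commute)
  have neg: "(\<integral>\<^sup>+x. G x \<partial>lborel) = (\<integral>\<^sup>+x. G (- x) \<partial>lborel)"
    if [measurable]: "G \<in> borel_measurable borel" for G :: "'a \<Rightarrow> ennreal"
    by (subst lborel_affine[of "- 1" 0]) (auto simp: nn_integral_density nn_integral_distr one_ennreal_def[symmetric])
  have "emeasure lborel U * (\<integral>\<^sup>+x. F (T x) \<partial>lborel) =
      (\<integral>\<^sup>+x. F (T x) * (\<integral>\<^sup>+y. indicator U y \<partial>lborel) \<partial>lborel)"
    by (simp add: nn_integral_multc mult.commute)
  also have "\<dots> = (\<integral>\<^sup>+x. \<integral>\<^sup>+y. F (T x) * indicator U (T x + y) \<partial>lborel \<partial>lborel)"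
    using shift[of "indicator U"] by (intro nn_integral_cong) (simp add: nn_integral_cmult)
  also have "\<dots> = (\<integral>\<^sup>+y. \<integral>\<^sup>+x. F (T x) * indicator U (T x + y) \<partial>lborel \<partial>lborel)"
    by (intro lborel_pair.Fubini') measurable
  also have "\<dots> = (\<integral>\<^sup>+y. \<integral>\<^sup>+x. F (T x - y) * indicator U (T x) \<partial>lborel \<partial>lborel)"
  proof (rule nn_integral_cong)
    fix y
    obtain c where c: "T c = - y" using T by (metis bij_pointE)
    show "(\<integral>\<^sup>+x. F (T x) * indicator U (T x + y) \<partial>lborel) = (\<integral>\<^sup>+x. F (T x - y) * indicator U (T x) \<partial>lborel)"
      using shift[of "\<lambda>x. F (T x) * indicator U (T x + y)" c] by (simp add: linear_add[OF T(1)] c)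
  qed
  also have "\<dots> = (\<integral>\<^sup>+x. \<integral>\<^sup>+y. F (T x - y) * indicator U (T x) \<partial>lborel \<partial>lborel)"
    by (intro lborel_pair.Fubini') measurable
  also have "\<dots> = (\<integral>\<^sup>+x. indicator (T -` U) x * (\<integral>\<^sup>+y. F y \<partial>lborel) \<partial>lborel)"
  proof (rule nn_integral_cong)
    fix x
    have "(\<integral>\<^sup>+y. F y \<partial>lborel) = (\<integral>\<^sup>+y. F (T x - y) \<partial>lborel)"
      by (subst shift[of _ "T x"], simp, subst neg) auto
    then show "(\<integral>\<^sup>+y. F (T x - y) * indicator U (T x) \<partial>lborel) = indicator (T -` U) x * (\<integral>\<^sup>+y. F y \<partial>lborel)"
      by (simp add: nn_integral_multc indicator_def)
  qed
  also have "\<dots> = emeasure lborel (T -` U) * (\<integral>\<^sup>+x. F x \<partial>lborel)"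
    using measurable_sets_borel[of T borel U] by (simp add: nn_integral_multc)
  finally show ?thesis .
qed

text \<open>An orthogonal map preserves the unit ball, so with the ball as test set the factor is 1;
  its measure is positive and finite and can be cancelled.\<close>

lemma nn_integral_orthogonal_substitution:
  fixes T :: "'a::euclidean_space \<Rightarrow> 'a" and F :: "'a \<Rightarrow> ennreal"
  assumes T: "orthogonal_transformation T" and [measurable]: "F \<in> borel_measurable borel"
  shows "(\<integral>\<^sup>+x. F (T x) \<partial>lborel) = (\<integral>\<^sup>+x. F x \<partial>lborel)"
proof -
  have "T -` ball 0 1 = ball 0 1"
    using T by (auto simp: orthogonal_transformation_norm)
  then have "emeasure lborel (ball 0 1 :: 'a set) * (\<integral>\<^sup>+x. F (T x) \<partial>lborel) =
      emeasure lborel (ball 0 1 :: 'a set) * (\<integral>\<^sup>+x. F x \<partial>lborel)"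
    using nn_integral_linear_substitution[of T F "ball 0 1"] T
    by (simp add: orthogonal_transformation_linear orthogonal_transformation_bij)
  moreover have "emeasure lborel (ball 0 1 :: 'a set) \<noteq> 0" "emeasure lborel (ball 0 1 :: 'a set) \<noteq> \<infinity>"
    using emeasure_bounded_finite[of "ball 0 1 :: 'a set"] open_not_negligible[of "ball 0 1 :: 'a set"]
    by (auto simp: negligible_iff_emeasure0)
  ultimately show ?thesis
    by (simp add: ennreal_mult_cancel_left)
qed

text \<open>The factor stays abstract because it cancels later. It is positive and finite since the
  preimage of the unit ball is open, nonempty and bounded.\<close>

lemma nn_integral_linear_substitution_ex:
  fixes T :: "'a::euclidean_space \<Rightarrow> 'a"
  assumes T: "linear T" "bij T"
  obtains c :: real where "0 < c"
    and "\<And>F :: 'a \<Rightarrow> ennreal. F \<in> borel_measurable borel \<Longrightarrow>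
      (\<integral>\<^sup>+x. F x \<partial>lborel) = ennreal c * (\<integral>\<^sup>+x. F (T x) \<partial>lborel)"
proof -
  let ?B = "ball 0 1 :: 'a set"
  obtain S where S: "linear S" "S \<circ> T = id"
    using linear_injective_left_inverse[OF T(1) bij_is_inj[OF T(2)]] by blast
  then have ST: "S (T x) = x" for x
    by (metis comp_apply id_apply)
  have "T -` ?B \<subseteq> S ` ?B"
  proof
    fix x assume "x \<in> T -` ?B"
    then show "x \<in> S ` ?B" using ST by (intro image_eqI[of _ S "T x"]) auto
  qed
  then have "bounded (T -` ?B)"
    using S bounded_subset[OF bounded_linear_image[of ?B S]] by (simp add: linear_conv_bounded_linear)
  moreover have "open (T -` ?B)"
    using T by (intro open_vimage linear_continuous_on) (auto simp: linear_conv_bounded_linear)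
  moreover have "T -` ?B \<noteq> {}"
    using linear_0[OF T(1)] by (metis centre_in_ball empty_iff vimageI zero_less_one)
  ultimately have 1: "emeasure lborel (T -` ?B) \<noteq> 0" "emeasure lborel (T -` ?B) < \<infinity>"
    using emeasure_bounded_finite[of "T -` ?B"] open_not_negligible[of "T -` ?B"]
    by (auto simp: negligible_iff_emeasure0)
  have 2: "emeasure lborel ?B \<noteq> 0" "emeasure lborel ?B < \<infinity>"
    using emeasure_bounded_finite[of ?B] open_not_negligible[of ?B]
    by (auto simp: negligible_iff_emeasure0)
  define u where "u = enn2real (emeasure lborel (T -` ?B))"
  define v where "v = enn2real (emeasure lborel ?B)"
  have u: "emeasure lborel (T -` ?B) = ennreal u" "0 < u"
    using 1 by (auto simp: u_def enn2real_positive_iff zero_less_iff_neq_zero)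
  have v: "emeasure lborel ?B = ennreal v" "0 < v"
    using 2 by (auto simp: v_def enn2real_positive_iff zero_less_iff_neq_zero)
  show ?thesis
  proof (rule that[of "v / u"])
    fix F :: "'a \<Rightarrow> ennreal" assume F: "F \<in> borel_measurable borel"
    have "ennreal v * (\<integral>\<^sup>+x. F (T x) \<partial>lborel) = ennreal u * (\<integral>\<^sup>+x. F x \<partial>lborel)"
      using nn_integral_linear_substitution[OF T F, of ?B] u v by simp
    then have "ennreal (1 / u) * (ennreal v * (\<integral>\<^sup>+x. F (T x) \<partial>lborel)) = ennreal (1 / u) * (ennreal u * (\<integral>\<^sup>+x. F x \<partial>lborel))"
      by simp
    then show "(\<integral>\<^sup>+x. F x \<partial>lborel) = ennreal (v / u) * (\<integral>\<^sup>+x. F (T x) \<partial>lborel)"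
      using u v by (simp add: mult.assoc[symmetric] flip: ennreal_mult'')
  qed (use u v in auto)
qed

section \<open>Finite systems of reflections\<close>

text \<open>Without division by \<open>a \<bullet> a\<close> this is a reflection for unit vectors
  \<open>a\<close> only, but it is continuous in \<open>a\<close> everywhere, which later makes a
  set of roots closed.\<close>

definition reflect :: "'a::real_inner \<Rightarrow> 'a \<Rightarrow> 'a" where
  "reflect a x = x - (2 * (a \<bullet> x)) *\<^sub>R a"

lemma linear_reflect: "linear (reflect a)"
  by (rule linearI) (auto simp: reflect_def inner_add_right algebra_simps)

lemma inner_reflect_reflect:
  assumes "norm a = 1"
  shows "reflect a x \<bullet> reflect a y = x \<bullet> y"
proof -
  have "a \<bullet> a = 1" using assms by (simp add: dot_square_norm)
  then show ?thesis
    by (simp add: reflect_def inner_diff_left inner_diff_right inner_commute algebra_simps)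
qed

lemma orthogonal_transformation_reflect: "norm a = 1 \<Longrightarrow> orthogonal_transformation (reflect a)"
  by (simp add: orthogonal_transformation_def linear_reflect inner_reflect_reflect)

lemma reflect_involution:
  assumes "norm a = 1"
  shows "reflect a (reflect a x) = x"
proof -
  have "a \<bullet> a = 1" using assms by (simp add: dot_square_norm)
  then show ?thesis
    by (simp add: reflect_def inner_diff_right algebra_simps)
qed

lemma reflect_self: "norm a = 1 \<Longrightarrow> reflect a a = - a"
  by (simp add: reflect_def dot_square_norm scaleR_2)

lemma reflect_orthogonal: "a \<bullet> x = 0 \<Longrightarrow> reflect a x = x"
  by (simp add: reflect_def)

lemma inner_reflect: "x \<bullet> reflect a y = x \<bullet> y - 2 * (a \<bullet> y) * (x \<bullet> a)"
  by (simp add: reflect_def inner_diff_right)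

text \<open>Conjugating a reflection by an orthogonal map gives the reflection in the image of its
  normal. Hence the normals of all reflections preserving a given set are stable under their own
  reflections.\<close>

lemma reflect_reflect:
  assumes "norm a = 1"
  shows "reflect (reflect a b) x = reflect a (reflect b (reflect a x))"
proof -
  have "reflect a b \<bullet> x = b \<bullet> reflect a x"
    using inner_reflect_reflect[OF assms, of b "reflect a x"] by (simp add: reflect_involution assms)
  then show ?thesis
    by (simp add: reflect_def[of b] reflect_def[of "reflect a b"] linear_diff[OF linear_reflect]
        linear_cmul[OF linear_reflect] reflect_involution assms)
qed

text \<open>The root systems of reflection groups, with roots scaled to length 1 and without
  integrality; they may be infinite and need not span. The case \<open>b = a\<close> puts
  \<open>- a\<close> into \<open>R\<close>.\<close>

definition unit_root_system :: "'a::real_inner set \<Rightarrow> bool" where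
  "unit_root_system R \<longleftrightarrow> R \<subseteq> sphere 0 1 \<and> (\<forall>a\<in>R. \<forall>b\<in>R. reflect a b \<in> R)"

lemma unit_root_systemD:
  assumes "unit_root_system R"
  shows "a \<in> R \<Longrightarrow> norm a = 1" "a \<in> R \<Longrightarrow> b \<in> R \<Longrightarrow> reflect a b \<in> R" "a \<in> R \<Longrightarrow> - a \<in> R"
  using assms by (force simp: unit_root_system_def reflect_self[symmetric])+

text \<open>Reflecting \<open>e \<beta>\<close> in the hyperplane normal to \<open>e \<alpha>\<close> gives \<open>- e (2 * \<alpha> - \<beta>)\<close>, so a small angle
  between two roots propagates to all its multiples.\<close>

lemma unit_root_system_angle_multiples:
  assumes R: "unit_root_system R" and au: "norm a = 1" "norm u = 1" "a \<bullet> u = 0"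
    and "a \<in> R" "cos \<phi> *\<^sub>R a + sin \<phi> *\<^sub>R u \<in> R"
  shows "cos (real m * \<phi>) *\<^sub>R a + sin (real m * \<phi>) *\<^sub>R u \<in> R"
proof -
  define e where "e \<alpha> = cos \<alpha> *\<^sub>R a + sin \<alpha> *\<^sub>R u" for \<alpha>
  have e: "e \<alpha> \<bullet> e \<beta> = cos (\<alpha> - \<beta>)" for \<alpha> \<beta>
    using au by (simp add: e_def inner_add_left inner_add_right dot_square_norm inner_commute[of u a] cos_diff)
  have refl: "- reflect (e \<alpha>) (e \<beta>) = e (2 * \<alpha> - \<beta>)" for \<alpha> \<beta>
  proof -
    have "2 * cos (\<alpha> - \<beta>) * cos \<alpha> = cos (2 * \<alpha> - \<beta>) + cos \<beta>"
      using cos_times_cos[of "\<alpha> - \<beta>" \<alpha>] by (simp add: algebra_simps)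
    moreover have "2 * cos (\<alpha> - \<beta>) * sin \<alpha> = sin (2 * \<alpha> - \<beta>) + sin \<beta>"
      using sin_times_cos[of \<alpha> "\<alpha> - \<beta>"] by (simp add: algebra_simps)
    ultimately show ?thesis
      by (simp add: reflect_def e) (simp add: e_def scaleR_add_right scaleR_add_left algebra_simps)
  qed
  \<comment> \<open>Two consecutive multiples are carried along: for
    \<open>\<alpha> = real (Suc m) * \<phi>\<close> and \<open>\<beta> = real m * \<phi>\<close> the
    angle \<open>2 * \<alpha> - \<beta>\<close> is the next one.\<close>
  have "e (real m * \<phi>) \<in> R \<and> e (real (Suc m) * \<phi>) \<in> R"
  proof (induction m)
    case 0
    then show ?case using assms by (simp add: e_def)
  next
    case (Suc m)
    have "e (2 * (real (Suc m) * \<phi>) - real m * \<phi>) \<in> R"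
      unfolding refl[symmetric] using Suc R by (intro unit_root_systemD) auto
    moreover have "2 * (real (Suc m) * \<phi>) - real m * \<phi> = real (Suc (Suc m)) * \<phi>"
      by (simp add: algebra_simps)
    ultimately show ?case using Suc by simp
  qed
  then show ?thesis by (simp add: e_def)
qed

text \<open>Infinitely many unit vectors accumulate at some \<open>a\<close>, so there are roots at
  angles \<open>\<theta> n\<close> from \<open>a\<close> tending to 0, in unit directions
  \<open>v n\<close>. All multiples of \<open>\<theta> n\<close> are angles of roots in the plane of
  \<open>a\<close> and \<open>v n\<close>. These become dense while a subsequence of
  \<open>v n\<close> converges to \<open>u\<close>, and closedness yields the full circle.\<close>

lemma infinite_unit_root_system_contains_circle:
  fixes R :: "'a::euclidean_space set"
  assumes R: "unit_root_system R" and "closed R" "infinite R"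
  obtains a u where "norm a = 1" "norm u = 1" "a \<bullet> u = 0"
    and "\<And>x y. x\<^sup>2 + y\<^sup>2 = 1 \<Longrightarrow> x *\<^sub>R a + y *\<^sub>R u \<in> R"
proof -
  have "R \<subseteq> sphere 0 1" using R by (simp add: unit_root_system_def)
  then obtain a where a: "a islimpt R"
    using \<open>infinite R\<close> compact_sphere[of "0::'a" 1] by (meson compact_eq_Bolzano_Weierstrass)
  then have aR: "a \<in> R" using \<open>closed R\<close> closed_limpt by blast
  then have na: "norm a = 1" using R unit_root_systemD by blast
  obtain f0 where f0: "\<And>n. f0 n \<in> R - {a}" "f0 \<longlonglongrightarrow> a"
    using a by (auto simp: islimpt_sequential)
  \<comment> \<open>Dropping finitely many terms makes the inner product with \<open>a\<close>
    positive. This excludes \<open>- a\<close>, so the part \<open>w n\<close> orthogonal to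
    \<open>a\<close> is nonzero and can be normalised.\<close>
  have "(\<lambda>n. a \<bullet> f0 n) \<longlonglongrightarrow> a \<bullet> a" by (intro tendsto_intros f0)
  then have "eventually (\<lambda>n. 0 < a \<bullet> f0 n) sequentially"
    using na by (intro order_tendstoD(1)) (auto simp: dot_square_norm)
  then obtain N where N: "\<And>n. n \<ge> N \<Longrightarrow> 0 < a \<bullet> f0 n" by (auto simp: eventually_sequentially)
  define f where "f n = f0 (n + N)" for n
  have f: "f n \<in> R" "f n \<noteq> a" "norm (f n) = 1" "0 < a \<bullet> f n" for n
    using f0(1)[of "n + N"] N[of "n + N"] unit_root_systemD(1)[OF R] by (auto simp: f_def)
  have flim: "f \<longlonglongrightarrow> a" unfolding f_def using f0(2) by (rule LIMSEQ_ignore_initial_segment)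
  define c where "c n = a \<bullet> f n" for n
  have c: "0 < c n" "c n < 1" for n
  proof -
    show "0 < c n" using f by (simp add: c_def)
    have "c n \<le> 1" using norm_cauchy_schwarz[of a "f n"] f na by (simp add: c_def)
    moreover have "c n \<noteq> 1"
    proof
      assume "c n = 1"
      moreover have "a \<bullet> a = 1" "f n \<bullet> f n = 1"
        using f[of n] na by (simp_all add: dot_square_norm)
      ultimately have "(f n - a) \<bullet> (f n - a) = 0"
        unfolding inner_diff_left inner_diff_right inner_commute[of "f n" a] c_def by linarith
      then show False using f[of n] by simp
    qed
    ultimately show "c n < 1" by simp
  qed
  define w where "w n = f n - c n *\<^sub>R a" for n
  have nw: "(norm (w n))\<^sup>2 = 1 - (c n)\<^sup>2" for n
  proof -
    have "a \<bullet> a = 1" "f n \<bullet> f n = 1"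
      using f[of n] na by (simp_all add: dot_square_norm)
    then show ?thesis
      unfolding power2_norm_eq_inner w_def
      by (simp add: inner_diff_left inner_diff_right inner_commute[of "f n" a] power2_eq_square c_def)
  qed
  have aw: "a \<bullet> w n = 0" for n
    using na by (simp add: w_def inner_diff_right dot_square_norm c_def)
  define \<theta> where "\<theta> n = arccos (c n)" for n
  have \<theta>: "cos (\<theta> n) = c n" "sin (\<theta> n) = norm (w n)" "0 < \<theta> n" "0 < norm (w n)" for n
  proof -
    show "cos (\<theta> n) = c n" using c[of n] by (simp add: \<theta>_def)
    have "sin (\<theta> n) = sqrt (1 - (c n)\<^sup>2)" using c[of n] by (simp add: \<theta>_def sin_arccos)
    then show "sin (\<theta> n) = norm (w n)" by (simp flip: nw)
    show "0 < \<theta> n" using arccos_less_arccos[of "c n" 1] c[of n] by (simp add: \<theta>_def)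
    have "(c n)\<^sup>2 < 1" using c[of n] by (simp add: abs_square_less_1)
    then show "0 < norm (w n)" using nw[of n] by auto
  qed
  define v where "v n = w n /\<^sub>R norm (w n)" for n
  have v: "norm (v n) = 1" "a \<bullet> v n = 0" "f n = cos (\<theta> n) *\<^sub>R a + sin (\<theta> n) *\<^sub>R v n" for n
    using \<theta>[of n] aw[of n] by (auto simp: v_def w_def)
  obtain u r where r: "strict_mono r" and u: "u \<in> sphere 0 1" "(v \<circ> r) \<longlonglongrightarrow> u"
    using compact_sphere[of "0::'a" 1] v(1) unfolding compact_def by (metis mem_sphere_0)
  have "c \<longlonglongrightarrow> a \<bullet> a" unfolding c_def by (intro tendsto_intros flim)
  then have "c \<longlonglongrightarrow> 1" using na by (simp add: dot_square_norm)
  then have "(\<lambda>n. arccos (c n)) \<longlonglongrightarrow> arccos 1"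
    using c by (intro continuous_on_tendsto_compose[OF continuous_on_arccos'])
      (auto intro!: always_eventually simp: less_imp_le intro: order_trans[of _ 0])
  then have \<theta>lim: "(\<lambda>n. \<theta> (r n)) \<longlonglongrightarrow> 0"
    using LIMSEQ_subseq_LIMSEQ[OF _ r] by (fastforce simp: \<theta>_def comp_def)
  have au: "a \<bullet> u = 0"
  proof -
    have "(\<lambda>n. a \<bullet> (v \<circ> r) n) \<longlonglongrightarrow> a \<bullet> u" by (intro tendsto_intros u)
    then show ?thesis using v by (simp add: LIMSEQ_const_iff)
  qed
  have circle: "cos \<alpha> *\<^sub>R a + sin \<alpha> *\<^sub>R u \<in> R" if "0 \<le> \<alpha>" for \<alpha>
  proof -
    \<comment> \<open>Rounding down makes the multiple miss \<open>\<alpha>\<close> by at most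
      \<open>\<theta> (r n)\<close>, which tends to 0.\<close>
    define m where "m n = nat \<lfloor>\<alpha> / \<theta> (r n)\<rfloor>" for n
    have m: "\<bar>real (m n) * \<theta> (r n) - \<alpha>\<bar> \<le> \<theta> (r n)" for n
    proof -
      have nn: "0 \<le> \<alpha> / \<theta> (r n)" using that \<theta>(3)[of "r n"] by simp
      have "real (m n) \<le> \<alpha> / \<theta> (r n)" "\<alpha> / \<theta> (r n) \<le> real (m n) + 1"
        unfolding m_def using nn by linarith+
      then show ?thesis using \<theta>(3)[of "r n"] by (simp add: field_simps abs_le_iff)
    qed
    have mlim: "(\<lambda>n. real (m n) * \<theta> (r n)) \<longlonglongrightarrow> \<alpha>"
      by (rule LIM_zero_cancel, rule Lim_null_comparison[OF _ \<theta>lim]) (use m in auto)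
    have lim: "(\<lambda>n. cos (real (m n) * \<theta> (r n)) *\<^sub>R a + sin (real (m n) * \<theta> (r n)) *\<^sub>R (v \<circ> r) n)
        \<longlonglongrightarrow> cos \<alpha> *\<^sub>R a + sin \<alpha> *\<^sub>R u"
      by (intro tendsto_intros mlim u)
    have "cos (real (m n) * \<theta> (r n)) *\<^sub>R a + sin (real (m n) * \<theta> (r n)) *\<^sub>R (v \<circ> r) n \<in> R" for n
      using unit_root_system_angle_multiples[OF R na v(1,2)[of "r n"] aR, of "\<theta> (r n)" "m n"] f(1)[of "r n"] v(3)[of "r n"]
      by simp
    from closed_sequentially[OF \<open>closed R\<close> this lim] show ?thesis .
  qed
  show ?thesis
  proof (rule that[of a u])
    fix x y :: real assume "x\<^sup>2 + y\<^sup>2 = 1"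
    then obtain \<alpha> where "0 \<le> \<alpha>" "x = cos \<alpha>" "y = sin \<alpha>" by (metis sincos_total_2pi)
    then show "x *\<^sub>R a + y *\<^sub>R u \<in> R" using circle by simp
  qed (use na u au in auto)
qed

text \<open>If \<open>R\<close> contains the unit circle spanned by \<open>a\<close> and \<open>u\<close>, every root can be reflected in a member
  of that circle so that it becomes orthogonal to \<open>a\<close>; so passing to the roots orthogonal
  to \<open>a\<close> loses only the line through \<open>a\<close>.\<close>

lemma finite_unit_root_subsystem:
  fixes R :: "'a::euclidean_space set"
  assumes "unit_root_system R" "closed R"
  shows "\<exists>S\<subseteq>R. finite S \<and> unit_root_system S \<and> R \<subseteq> span S"
  using assms
proof (induction "dim R" arbitrary: R rule: less_induct)
  case less
  note R = less.prems(1)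
  show ?case
  proof (cases "finite R")
    case True
    then show ?thesis using R span_superset by blast
  next
    case False
    then obtain a u where au: "norm a = 1" "norm u = 1" "a \<bullet> u = 0"
      and circle: "\<And>x y. x\<^sup>2 + y\<^sup>2 = 1 \<Longrightarrow> x *\<^sub>R a + y *\<^sub>R u \<in> R"
      using infinite_unit_root_system_contains_circle[OF less.prems] by blast
    have aR: "a \<in> R" and uR: "u \<in> R" using circle[of 1 0] circle[of 0 1] by auto
    define R' where "R' = R \<inter> {x. a \<bullet> x = 0}"
    have R': "unit_root_system R'"
      using R by (auto simp: unit_root_system_def R'_def inner_reflect)
    have "closed R'" unfolding R'_def using less.prems by (intro closed_Int closed_hyperplane)
    have "span R' \<subseteq> {x. a \<bullet> x = 0}"
      by (rule span_minimal) (auto simp: R'_def subspace_hyperplane)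
    then have "a \<notin> span R'" using au by auto
    moreover have "a \<in> span R" using aR by (rule span_base)
    moreover have "span R' \<subseteq> span R" by (intro span_mono) (auto simp: R'_def)
    ultimately have "dim R' < dim R" by (intro dim_psubset) auto
    from less.hyps[OF this R' \<open>closed R'\<close>] obtain S where
      S: "S \<subseteq> R'" "finite S" "unit_root_system S" "R' \<subseteq> span S" by blast
    \<comment> \<open>\<open>S\<close> is orthogonal to \<open>a\<close>, so the reflection in
      \<open>a\<close> fixes \<open>S\<close> pointwise and reflections in \<open>S\<close> fix
      \<open>a\<close>; adding the pair \<open>a\<close>, \<open>- a\<close> keeps the system
      stable.\<close>
    let ?S = "insert a (insert (- a) S)"
    have "unit_root_system ?S"
    proof -
      have "a \<bullet> b = 0" "b \<bullet> a = 0" if "b \<in> S" for b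
        using that S by (auto simp: R'_def inner_commute)
      moreover have "reflect a a = - a" "reflect a (- a) = a" "reflect (- a) a = - a" "reflect (- a) (- a) = a"
        using au by (auto simp: reflect_def dot_square_norm scaleR_2)
      ultimately show ?thesis
        using S(3) au by (auto simp: unit_root_system_def reflect_orthogonal)
    qed
    moreover have "R \<subseteq> span ?S"
    proof
      fix b assume b: "b \<in> R"
      have sub: "span S \<subseteq> span ?S" by (intro span_mono) auto
      have a: "a \<in> span ?S" by (intro span_base) auto
      have u: "u \<in> span ?S" using uR au S sub by (auto simp: R'_def)
      show "b \<in> span ?S"
      proof (cases "a \<bullet> b = 0")
        case True
        then show ?thesis using b S sub by (auto simp: R'_def)
      next
        case F: False
        \<comment> \<open>\<open>p\<close> and \<open>q\<close> are the coordinates of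
          \<open>b\<close> in the plane of the circle, and \<open>r\<close> is the length of that
          projection. The unit vector \<open>c\<close> is the normalised difference of the
          projection and \<open>r *\<^sub>R u\<close>, so reflecting in \<open>c\<close> turns the
          projection into \<open>r *\<^sub>R u\<close>, which is orthogonal to
          \<open>a\<close>.\<close>
        define p q where "p = a \<bullet> b" and "q = u \<bullet> b"
        define r where "r = sqrt (p\<^sup>2 + q\<^sup>2)"
        define N where "N = sqrt (p\<^sup>2 + (q - r)\<^sup>2)"
        have r2: "r\<^sup>2 = p\<^sup>2 + q\<^sup>2" by (simp add: r_def)
        have N2: "N\<^sup>2 = p\<^sup>2 + (q - r)\<^sup>2" by (simp add: N_def)
        have "p \<noteq> 0" using F by (simp add: p_def)
        then have "0 < N" unfolding N_def by (simp add: sum_power2_gt_zero_iff)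
        define c where "c = (p / N) *\<^sub>R a + ((q - r) / N) *\<^sub>R u"
        have "(p / N)\<^sup>2 + ((q - r) / N)\<^sup>2 = 1"
          using \<open>0 < N\<close> by (simp add: power_divide add_divide_distrib[symmetric] N2[symmetric])
        then have "c \<in> R" unfolding c_def by (rule circle)
        then have cb: "reflect c b \<in> R" using R b unit_root_systemD by blast
        have "2 * (c \<bullet> b) = 2 * (p * p + (q - r) * q) / N"
          using \<open>0 < N\<close> by (simp add: c_def inner_add_left p_def[symmetric] q_def[symmetric] field_simps)
        also have "2 * (p * p + (q - r) * q) = N\<^sup>2"
          using r2 N2 by (simp add: power2_eq_square algebra_simps)
        finally have "2 * (c \<bullet> b) = N" using \<open>0 < N\<close> by (simp add: power2_eq_square)
        then have eq: "reflect c b = b - (p *\<^sub>R a + (q - r) *\<^sub>R u)"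
          using \<open>0 < N\<close> by (simp add: reflect_def c_def scaleR_add_right)
        then have "a \<bullet> reflect c b = 0"
          using au by (simp add: inner_diff_right inner_add_right dot_square_norm p_def)
        then have "reflect c b \<in> span ?S" using cb S sub by (auto simp: R'_def)
        moreover have "b = reflect c b + (p *\<^sub>R a + (q - r) *\<^sub>R u)" by (simp add: eq)
        ultimately show ?thesis
          using a u by (metis span_add span_scale)
      qed
    qed
    moreover have "?S \<subseteq> R" "finite ?S"
      using S aR unit_root_systemD(3)[OF R aR] by (auto simp: R'_def)
    ultimately show ?thesis by blast
  qed
qed

section \<open>The symmetry group and dominant vectors\<close>

text \<open>A linear map is determined by its values on the spanning set \<open>S\<close>, and
  \<open>S\<close> has finitely many maps to itself. \<open>P\<close> leaves room for further
  invariance conditions.\<close>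

lemma finite_orthogonal_stabilizer:
  fixes S :: "'a::euclidean_space set"
  assumes "finite S" "span S = UNIV"
  shows "finite {g. orthogonal_transformation g \<and> g ` S = S \<and> P g}"
proof (rule finite_imageD)
  let ?G = "{g. orthogonal_transformation g \<and> g ` S = S \<and> P g}"
  show "finite ((\<lambda>g. restrict g S) ` ?G)"
    by (rule finite_subset[of _ "S \<rightarrow>\<^sub>E S"]) (use assms in \<open>auto intro: finite_PiE\<close>)
  show "inj_on (\<lambda>g. restrict g S) ?G"
  proof (rule inj_onI)
    fix g h assume gh: "g \<in> ?G" "h \<in> ?G" "restrict g S = restrict h S"
    have "g x = h x" if "x \<in> S" for x
      using fun_cong[OF gh(3), of x] that by simp
    then have "g x = h x" for x
      using gh assms by (intro linear_eq_on[of g h x S]) (auto simp: orthogonal_transformation_linear)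
    then show "g = h" by auto
  qed
qed

text \<open>The full stabiliser stands in for the group generated by the reflections: it contains
  those that preserve the sets in \<open>\<S>\<close>, and its members preserve these sets by
  definition. For \<open>\<S>\<close> the bodies \<open>K\<close> and \<open>L\<close> are taken
  later.\<close>

definition root_symmetries :: "'a::euclidean_space set \<Rightarrow> 'a set set \<Rightarrow> ('a \<Rightarrow> 'a) set" where
  "root_symmetries R \<S> = {g. orthogonal_transformation g \<and> g ` R = R \<and> (\<forall>S\<in>\<S>. g ` S = S)}"

lemma reflect_mem_root_symmetries:
  assumes "unit_root_system R" "a \<in> R" "\<And>S. S \<in> \<S> \<Longrightarrow> reflect a ` S = S"
  shows "reflect a \<in> root_symmetries R \<S>"
proof -
  have "norm a = 1" by (rule unit_root_systemD(1)[OF assms(1,2)])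
  have cl: "reflect a b \<in> R" if "b \<in> R" for b
    by (rule unit_root_systemD(2)[OF assms(1,2) that])
  have "reflect a ` R = R"
  proof
    show "reflect a ` R \<subseteq> R" using cl by auto
    show "R \<subseteq> reflect a ` R"
    proof
      fix b assume "b \<in> R"
      then show "b \<in> reflect a ` R"
        using cl \<open>norm a = 1\<close> by (intro image_eqI[of _ _ "reflect a b"]) (auto simp: reflect_involution)
    qed
  qed
  then show ?thesis
    using assms \<open>norm a = 1\<close> by (auto simp: root_symmetries_def orthogonal_transformation_reflect)
qed

text \<open>Choose \<open>g\<close> in the finite group with \<open>w \<bullet> g u\<close> maximal.
  If some root \<open>a\<close> had \<open>0 < a \<bullet> w\<close> and
  \<open>a \<bullet> g u < 0\<close>, following \<open>g\<close> by the reflection in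
  \<open>a\<close> would increase this value.\<close>

lemma root_symmetries_dominant:
  fixes R :: "'a::euclidean_space set"
  assumes R: "unit_root_system R" "finite R" "span R = UNIV"
    and inv: "\<And>a S. a \<in> R \<Longrightarrow> S \<in> \<S> \<Longrightarrow> reflect a ` S = S"
  obtains g where "g \<in> root_symmetries R \<S>" "w \<bullet> u \<le> w \<bullet> g u"
    and "\<And>a. a \<in> R \<Longrightarrow> 0 < a \<bullet> w \<Longrightarrow> 0 \<le> a \<bullet> g u"
proof -
  let ?G = "root_symmetries R \<S>"
  have "finite ?G"
    unfolding root_symmetries_def by (rule finite_orthogonal_stabilizer) (use R in auto)
  moreover have id: "id \<in> ?G"
    by (auto simp: root_symmetries_def orthogonal_transformation_id[unfolded id_def[symmetric]])
  ultimately have "Max ((\<lambda>g. w \<bullet> g u) ` ?G) \<in> (\<lambda>g. w \<bullet> g u) ` ?G"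
    by (intro Max_in) auto
  then obtain g where "g \<in> ?G" "Max ((\<lambda>g. w \<bullet> g u) ` ?G) = w \<bullet> g u" by auto
  then have g: "g \<in> ?G" "\<And>h. h \<in> ?G \<Longrightarrow> w \<bullet> h u \<le> w \<bullet> g u"
    using \<open>finite ?G\<close> by (metis Max_ge finite_imageI imageI)+
  show ?thesis
  proof (rule that[of g])
    show "w \<bullet> u \<le> w \<bullet> g u" using g(2)[OF id] by simp
    fix a assume a: "a \<in> R" "0 < a \<bullet> w"
    have ra: "reflect a \<in> ?G" using R a inv by (intro reflect_mem_root_symmetries)
    have "reflect a \<circ> g \<in> ?G"
    proof -
      have "(reflect a \<circ> g) ` X = X" if "reflect a ` X = X" "g ` X = X" for X
        using that by (metis image_comp)
      then show ?thesis
        using ra g(1) unfolding root_symmetries_def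
        by (simp add: orthogonal_transformation_compose)
    qed
    from g(2)[OF this] have "0 \<le> (a \<bullet> g u) * (w \<bullet> a)"
      by (simp add: inner_reflect mult.commute)
    then show "0 \<le> a \<bullet> g u"
      using a by (auto simp: inner_commute[of w a] zero_le_mult_iff)
  qed (use g in auto)
qed

section \<open>Cones, obtuse systems and simple roots\<close>

definition nonneg_span :: "'a::real_vector set \<Rightarrow> 'a set" where
  "nonneg_span S = {x. \<exists>k. (\<forall>s\<in>S. 0 \<le> k s) \<and> x = (\<Sum>s\<in>S. k s *\<^sub>R s)}"

lemma nonneg_span_scale: "x \<in> nonneg_span S \<Longrightarrow> 0 \<le> c \<Longrightarrow> c *\<^sub>R x \<in> nonneg_span S"
proof -
  assume "x \<in> nonneg_span S" "0 \<le> c"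
  then obtain k where "\<forall>s\<in>S. 0 \<le> k s" "x = (\<Sum>s\<in>S. k s *\<^sub>R s)"
    by (auto simp: nonneg_span_def)
  then show ?thesis
    unfolding nonneg_span_def using \<open>0 \<le> c\<close>
    by (intro CollectI exI[of _ "\<lambda>s. c * k s"]) (auto simp: scaleR_sum_right)
qed

lemma nonneg_span_add: "x \<in> nonneg_span S \<Longrightarrow> y \<in> nonneg_span S \<Longrightarrow> x + y \<in> nonneg_span S"
proof -
  assume "x \<in> nonneg_span S" "y \<in> nonneg_span S"
  then obtain k l where "\<forall>s\<in>S. 0 \<le> k s" "x = (\<Sum>s\<in>S. k s *\<^sub>R s)" "\<forall>s\<in>S. 0 \<le> l s" "y = (\<Sum>s\<in>S. l s *\<^sub>R s)"
    by (auto simp: nonneg_span_def)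
  then show ?thesis
    unfolding nonneg_span_def by (auto intro!: exI[of _ "\<lambda>s. k s + l s"] simp: scaleR_add_left sum.distrib)
qed

lemma nonneg_span_sum: "(\<And>i. i \<in> I \<Longrightarrow> f i \<in> nonneg_span S) \<Longrightarrow> sum f I \<in> nonneg_span S"
proof (induction I rule: infinite_finite_induct)
  case (insert i I)
  then show ?case by (simp add: nonneg_span_add)
qed (auto simp: nonneg_span_def intro!: exI[of _ "\<lambda>_. 0"])

lemma nonneg_span_superset:
  assumes "finite S"
  shows "S \<subseteq> nonneg_span S"
proof
  fix x assume "x \<in> S"
  then have "x = (\<Sum>s\<in>S. (if s = x then 1 else 0) *\<^sub>R s)"
    using assms by (subst sum.remove[of _ x]) auto
  then show "x \<in> nonneg_span S"
    unfolding nonneg_span_def by (intro CollectI exI[of _ "\<lambda>s. if s = x then 1 else 0"]) auto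
qed

lemma nonneg_span_minimal:
  assumes "S \<subseteq> nonneg_span T"
  shows "nonneg_span S \<subseteq> nonneg_span T"
  using assms unfolding nonneg_span_def[of S] by (auto intro!: nonneg_span_sum nonneg_span_scale)

lemma nonneg_span_subset_span: "nonneg_span S \<subseteq> span S"
  by (auto simp: nonneg_span_def intro!: span_sum span_scale intro: span_base)

text \<open>Split a vanishing combination into its positive part \<open>p\<close> and negative part
  \<open>n\<close>, so \<open>p = n\<close>. In \<open>p \<bullet> n\<close> the diagonal terms
  vanish and the others are nonpositive, hence \<open>p = n = 0\<close>. Since all of
  \<open>S\<close> lies strictly on one side, pairing with \<open>w\<close> kills every
  coefficient.\<close>

lemma obtuse_independent:
  fixes S :: "'a::euclidean_space set"
  assumes "finite S" and pos: "\<And>s. s \<in> S \<Longrightarrow> 0 < s \<bullet> w"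
    and obt: "\<And>s s'. s \<in> S \<Longrightarrow> s' \<in> S \<Longrightarrow> s \<noteq> s' \<Longrightarrow> s \<bullet> s' \<le> 0"
  shows "independent S"
proof -
  have "\<forall>v\<in>S. k v = 0" if 0: "(\<Sum>v\<in>S. k v *\<^sub>R v) = 0" for k
  proof -
    define p n where "p = (\<Sum>v\<in>S. max (k v) 0 *\<^sub>R v)" and "n = (\<Sum>v\<in>S. max (- k v) 0 *\<^sub>R v)"
    have "p - n = (\<Sum>v\<in>S. k v *\<^sub>R v)"
      unfolding p_def n_def sum_subtractf[symmetric] by (intro sum.cong) (auto simp: max_def)
    then have "p = n" using 0 by simp
    have "p \<bullet> n = (\<Sum>v\<in>S. \<Sum>v'\<in>S. (max (k v) 0 * max (- k v') 0) * (v \<bullet> v'))"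
      by (simp add: p_def n_def inner_sum_left inner_sum_right sum_distrib_left mult.assoc mult.left_commute)
        (rule sum.swap)
    also have "\<dots> \<le> 0"
    proof (intro sum_nonpos)
      fix v v' assume "v \<in> S" "v' \<in> S"
      then show "(max (k v) 0 * max (- k v') 0) * (v \<bullet> v') \<le> 0"
        using obt[of v v'] by (cases "v = v'") (auto simp: max_def mult_nonneg_nonpos)
    qed
    finally have "p \<bullet> p \<le> 0" using \<open>p = n\<close> by simp
    then have "p = 0" by (metis inner_eq_zero_iff inner_ge_zero order_antisym)
    have cancel: "max (c v) 0 = 0" if "(\<Sum>v\<in>S. max (c v) 0 *\<^sub>R v) = 0" "v \<in> S" for c v
    proof -
      have "(\<Sum>v\<in>S. max (c v) 0 * (v \<bullet> w)) = 0"
        using arg_cong[OF that(1), of "\<lambda>x. x \<bullet> w"] by (simp add: inner_sum_left)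
      moreover have "0 \<le> max (c v) 0 * (v \<bullet> w)" if "v \<in> S" for v
        using pos[OF that] by simp
      ultimately have "max (c v) 0 * (v \<bullet> w) = 0"
        using sum_nonneg_eq_0_iff[OF \<open>finite S\<close>, of "\<lambda>v. max (c v) 0 * (v \<bullet> w)"] that(2) by simp
      then show ?thesis using pos[OF that(2)] by auto
    qed
    show ?thesis
    proof
      fix v assume "v \<in> S"
      have "max (k v) 0 = 0"
        by (rule cancel) (use \<open>v \<in> S\<close> \<open>p = 0\<close> p_def in simp_all)
      moreover have "max (- k v) 0 = 0"
        by (rule cancel) (use \<open>v \<in> S\<close> \<open>p = 0\<close> \<open>p = n\<close> n_def in simp_all)
      ultimately show "k v = 0" by (simp add: max_def split: if_splits)
    qed
  qed
  then show ?thesis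
    using \<open>finite S\<close> by (auto simp: independent_explicit_finite_subsets dependent_finite)
qed

text \<open>With \<open>x = p - n\<close> split by the sign of the coefficients,
  \<open>n \<bullet> n = n \<bullet> p - n \<bullet> x\<close>. The first term is nonpositive by
  obtuseness and \<open>n \<bullet> x\<close> is nonnegative by hypothesis, so
  \<open>n = 0\<close>.\<close>

lemma obtuse_nonneg_span:
  fixes S :: "'a::euclidean_space set"
  assumes "finite S" and obt: "\<And>s s'. s \<in> S \<Longrightarrow> s' \<in> S \<Longrightarrow> s \<noteq> s' \<Longrightarrow> s \<bullet> s' \<le> 0"
    and x: "x \<in> span S" "\<And>s. s \<in> S \<Longrightarrow> 0 \<le> s \<bullet> x"
  shows "x \<in> nonneg_span S"
proof -
  obtain k where k: "x = (\<Sum>v\<in>S. k v *\<^sub>R v)"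
    using x(1) by (auto simp: span_finite[OF \<open>finite S\<close>])
  define p n where "p = (\<Sum>v\<in>S. max (k v) 0 *\<^sub>R v)" and "n = (\<Sum>v\<in>S. max (- k v) 0 *\<^sub>R v)"
  have pn: "x = p - n"
    unfolding p_def n_def k sum_subtractf[symmetric] by (intro sum.cong) (auto simp: max_def)
  have "n \<bullet> p = (\<Sum>v\<in>S. \<Sum>v'\<in>S. (max (- k v) 0 * max (k v') 0) * (v \<bullet> v'))"
    by (simp add: p_def n_def inner_sum_left inner_sum_right sum_distrib_left mult.assoc mult.left_commute)
      (rule sum.swap)
  also have "\<dots> \<le> 0"
  proof (intro sum_nonpos)
    fix v v' assume "v \<in> S" "v' \<in> S"
    then show "(max (- k v) 0 * max (k v') 0) * (v \<bullet> v') \<le> 0"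
      using obt[of v v'] by (cases "v = v'") (auto simp: max_def mult_nonneg_nonpos)
  qed
  finally have "n \<bullet> p \<le> 0" .
  moreover have "0 \<le> n \<bullet> x"
    using x(2) by (auto simp: n_def inner_sum_left intro!: sum_nonneg)
  ultimately have "n \<bullet> n \<le> 0" by (simp add: pn inner_diff_right)
  then have "n = 0" by (metis inner_eq_zero_iff inner_ge_zero order_antisym)
  then show ?thesis
    unfolding nonneg_span_def pn p_def by (intro CollectI exI[of _ "\<lambda>v. max (k v) 0"]) auto
qed

text \<open>\<open>S\<close> is a generating set of the positive roots of least cardinality. If
  \<open>a \<bullet> b > 0\<close> for distinct members, then
  \<open>reflect a b = b - c *\<^sub>R a\<close> with \<open>c > 0\<close> is a root, and it or its
  negative is a nonnegative combination of \<open>S\<close>. Solving for \<open>b\<close> or for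
  \<open>a\<close> writes one as a combination containing the other with positive coefficient,
  against minimality.\<close>

lemma simple_roots_exist:
  fixes R :: "'a::euclidean_space set"
  assumes R: "unit_root_system R" "finite R" and w: "\<And>a. a \<in> R \<Longrightarrow> a \<bullet> w \<noteq> 0"
  obtains S where "S \<subseteq> R" "\<And>s. s \<in> S \<Longrightarrow> 0 < s \<bullet> w"
    and "\<And>a. a \<in> R \<Longrightarrow> 0 < a \<bullet> w \<Longrightarrow> a \<in> nonneg_span S"
    and "\<And>s s'. s \<in> S \<Longrightarrow> s' \<in> S \<Longrightarrow> s \<noteq> s' \<Longrightarrow> s \<bullet> s' \<le> 0"
proof -
  define P where "P = {a \<in> R. 0 < a \<bullet> w}"
  have "finite P" using R by (simp add: P_def)
  define Q where "Q S \<longleftrightarrow> S \<subseteq> P \<and> P \<subseteq> nonneg_span S" for S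
  have "Q P" using nonneg_span_superset[OF \<open>finite P\<close>] by (simp add: Q_def)
  then obtain S where "Q S" and min: "\<And>T. Q T \<Longrightarrow> card S \<le> card T"
    using ex_has_least_nat[of Q P card] by metis
  then have S: "S \<subseteq> P" "P \<subseteq> nonneg_span S" by (simp_all add: Q_def)
  have "finite S" using S \<open>finite P\<close> finite_subset by blast
  have pos: "0 < s \<bullet> w" if "s \<in> S" for s using S that by (auto simp: P_def)
  have irred: "b \<notin> nonneg_span (S - {b})" if "b \<in> S" for b
  proof
    assume "b \<in> nonneg_span (S - {b})"
    then have "S \<subseteq> nonneg_span (S - {b})"
      using nonneg_span_superset[of "S - {b}"] \<open>finite S\<close> by auto
    then have "P \<subseteq> nonneg_span (S - {b})"
      using S(2) nonneg_span_minimal by blast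
    then have "card S \<le> card (S - {b})" using S by (intro min) (auto simp: Q_def)
    then show False using card_Diff1_less[OF \<open>finite S\<close> that] by simp
  qed
  \<comment> \<open>Moving the own coefficient of \<open>b\<close> to the left gives
    \<open>(1 - k b) *\<^sub>R b = y\<close>. The term of \<open>a\<close> makes
    \<open>y \<bullet> w\<close> positive, so \<open>1 - k b > 0\<close>, and \<open>b\<close> would
    be redundant in \<open>S\<close>.\<close>
  have coeff: False if "b \<in> S" "b = (\<Sum>s\<in>S. k s *\<^sub>R s)" "\<And>s. s \<in> S \<Longrightarrow> 0 \<le> k s"
    "a \<in> S" "a \<noteq> b" "0 < k a" for a b k
  proof -
    define y where "y = (\<Sum>s\<in>S - {b}. k s *\<^sub>R s)"
    have "b = k b *\<^sub>R b + y"
      using that(2) unfolding y_def sum.remove[OF \<open>finite S\<close> \<open>b \<in> S\<close>] .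
    then have y: "y = (1 - k b) *\<^sub>R b" by (simp add: algebra_simps)
    have "y \<bullet> w = (\<Sum>s\<in>S - {b}. k s * (s \<bullet> w))" by (simp add: y_def inner_sum_left)
    also have "\<dots> > 0"
      using that pos \<open>finite S\<close> by (intro sum_pos2[of _ a]) (auto intro!: mult_nonneg_nonneg intro: less_imp_le)
    finally have "0 < 1 - k b" using pos[OF \<open>b \<in> S\<close>] by (simp add: y zero_less_mult_iff)
    then have "b = (1 / (1 - k b)) *\<^sub>R y" by (simp add: y)
    moreover have "y \<in> nonneg_span (S - {b})"
      using that unfolding nonneg_span_def y_def by auto
    ultimately have "b \<in> nonneg_span (S - {b})"
      using \<open>0 < 1 - k b\<close> nonneg_span_scale[of y "S - {b}" "1 / (1 - k b)"] by simp
    then show False using irred \<open>b \<in> S\<close> by blast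
  qed
  have single: "(\<Sum>s\<in>S. (k s + (if s = a then c else 0)) *\<^sub>R s) = (\<Sum>s\<in>S. k s *\<^sub>R s) + c *\<^sub>R a"
    if "a \<in> S" for a k c
    using that \<open>finite S\<close>
    by (simp add: scaleR_add_left sum.distrib if_distrib[of "\<lambda>c. c *\<^sub>R _"] sum.delta cong: if_cong)
  have obt: "a \<bullet> b \<le> 0" if ab: "a \<in> S" "b \<in> S" "a \<noteq> b" for a b
  proof (rule ccontr)
    define c where "c = 2 * (a \<bullet> b)"
    assume "\<not> a \<bullet> b \<le> 0"
    then have "0 < c" by (simp add: c_def)
    have r: "reflect a b = b - c *\<^sub>R a" by (simp add: reflect_def c_def)
    have rR: "reflect a b \<in> R" by (intro unit_root_systemD(2)[OF R(1)]) (use ab S in \<open>auto simp: P_def\<close>)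
    show False
    proof (cases "0 < reflect a b \<bullet> w")
      case True
      then obtain k where k: "\<forall>s\<in>S. 0 \<le> k s" "b - c *\<^sub>R a = (\<Sum>s\<in>S. k s *\<^sub>R s)"
        using S rR unfolding r[symmetric] by (auto simp: P_def nonneg_span_def)
      have "b = (\<Sum>s\<in>S. (k s + (if s = a then c else 0)) *\<^sub>R s)"
        unfolding single[OF \<open>a \<in> S\<close>] k(2)[symmetric] by simp
      then show False
        using coeff[OF \<open>b \<in> S\<close>, of "\<lambda>s. k s + (if s = a then c else 0)" a] k ab \<open>0 < c\<close> by force
    next
      case False
      then have "0 < - reflect a b \<bullet> w" using w[OF rR] by (simp add: inner_minus_left)
      moreover have "- reflect a b \<in> R" using unit_root_systemD(3)[OF R(1) rR] .
      ultimately obtain k where k: "\<forall>s\<in>S. 0 \<le> k s" "c *\<^sub>R a - b = (\<Sum>s\<in>S. k s *\<^sub>R s)"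
        using S unfolding r by (auto simp: P_def nonneg_span_def)
      have "a = (1 / c) *\<^sub>R ((\<Sum>s\<in>S. k s *\<^sub>R s) + 1 *\<^sub>R b)"
        unfolding k(2)[symmetric] using \<open>0 < c\<close> by simp
      also have "\<dots> = (\<Sum>s\<in>S. ((k s + (if s = b then 1 else 0)) / c) *\<^sub>R s)"
        unfolding single[OF \<open>b \<in> S\<close>, symmetric] by (simp add: scaleR_sum_right divide_inverse mult.commute)
      finally show False
        using coeff[OF \<open>a \<in> S\<close>, of "\<lambda>s. (k s + (if s = b then 1 else 0)) / c" b] k ab \<open>0 < c\<close>
        by (force intro: divide_nonneg_pos divide_pos_pos)
    qed
  qed
  show ?thesis
    by (rule that[of S]) (use S pos obt in \<open>auto simp: P_def\<close>)
qed

text \<open>\<open>T\<close> sends the standard basis to the basis dual to the simple roots, so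
  coordinates of \<open>y\<close> are the values of the simple roots at \<open>T y\<close>. Each
  \<open>T b\<close> pairs nonnegatively with the simple roots, hence lies in their cone by
  obtuseness; both final inequalities follow by expanding \<open>T b\<close> in simple
  roots.\<close>

lemma chamber_coordinates:
  fixes R :: "'a::euclidean_space set"
  assumes R: "unit_root_system R" "finite R" "span R = UNIV" and w: "\<And>a. a \<in> R \<Longrightarrow> a \<bullet> w \<noteq> 0"
  obtains T :: "'a \<Rightarrow> 'a" where "linear T" "bij T"
    and "\<And>y. (\<forall>a\<in>R. 0 < a \<bullet> w \<longrightarrow> 0 < a \<bullet> T y) \<longleftrightarrow> (\<forall>b\<in>Basis. 0 < y \<bullet> b)"
    and "\<And>b b'. b \<in> Basis \<Longrightarrow> b' \<in> Basis \<Longrightarrow> 0 \<le> T b \<bullet> T b'"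
    and "\<And>u b. (\<forall>a\<in>R. 0 < a \<bullet> w \<longrightarrow> 0 \<le> a \<bullet> u) \<Longrightarrow> b \<in> Basis \<Longrightarrow> 0 \<le> T b \<bullet> u"
proof -
  obtain S where S: "S \<subseteq> R" "\<And>s. s \<in> S \<Longrightarrow> 0 < s \<bullet> w"
    "\<And>a. a \<in> R \<Longrightarrow> 0 < a \<bullet> w \<Longrightarrow> a \<in> nonneg_span S"
    "\<And>s s'. s \<in> S \<Longrightarrow> s' \<in> S \<Longrightarrow> s \<noteq> s' \<Longrightarrow> s \<bullet> s' \<le> 0"
    using simple_roots_exist[OF R(1,2) w] by blast
  have "finite S" using S R finite_subset by blast
  have "R \<subseteq> span S"
  proof
    fix a assume a: "a \<in> R"
    show "a \<in> span S"
    proof (cases "0 < a \<bullet> w")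
      case True
      then show ?thesis using S(3)[OF a] nonneg_span_subset_span by blast
    next
      case False
      then have "- a \<in> nonneg_span S"
        using w[OF a] unit_root_systemD(3)[OF R(1) a] by (intro S(3)) (auto simp: inner_minus_left)
      then show ?thesis using nonneg_span_subset_span span_neg[of "- a" S] by auto
    qed
  qed
  then have span: "span S = UNIV" using R(3) span_minimal[of R "span S"] by auto
  have "independent S" using obtuse_independent[OF \<open>finite S\<close> S(2,4)] .
  then have "card S = DIM('a)" using span by (metis dim_UNIV dim_eq_card dim_span)
  then obtain e :: "'a \<Rightarrow> 'a" where e: "bij_betw e Basis S"
    using finite_same_card_bij[OF finite_Basis \<open>finite S\<close>, where ?'a1 = 'a] by metis
  define A where "A x = (\<Sum>b\<in>Basis. (e b \<bullet> x) *\<^sub>R b :: 'a)" for x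
  have Ab: "A x \<bullet> b = e b \<bullet> x" if "b \<in> Basis" for x b using that by (simp add: A_def)
  have "linear A" unfolding A_def
    by (rule linearI) (auto simp: inner_add_right scaleR_add_left sum.distrib scaleR_sum_right)
  moreover have "inj A"
  proof (subst linear_injective_0[OF \<open>linear A\<close>], intro allI impI)
    fix x assume "A x = 0"
    then have "s \<bullet> x = 0" if "s \<in> S" for s
      using that e Ab by (metis bij_betw_def imageE inner_zero_left)
    then have "S \<subseteq> {y. x \<bullet> y = 0}" by (auto simp: inner_commute)
    then have "span S \<subseteq> {y. x \<bullet> y = 0}" by (rule span_minimal) (simp add: subspace_hyperplane)
    then have "x \<in> {y. x \<bullet> y = 0}" using span by blast
    then show "x = 0" by simp
  qed
  ultimately obtain T where T: "linear T" "\<And>x. T (A x) = x" "\<And>x. A (T x) = x"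
    using linear_injective_isomorphism by metis
  have "bij T" using T by (metis bijI')
  have eT: "e b \<bullet> T y = y \<bullet> b" if "b \<in> Basis" for b y
    using Ab[OF that, of "T y"] by (simp add: T)
  have eS: "e b \<in> S" if "b \<in> Basis" for b using e that by (auto simp: bij_betw_def)
  have Se: "\<exists>b\<in>Basis. s = e b" if "s \<in> S" for s using e that by (auto simp: bij_betw_def)
  have nonneg: "0 \<le> T b \<bullet> u" if "\<And>s. s \<in> S \<Longrightarrow> 0 \<le> s \<bullet> u" "b \<in> Basis" for u b
  proof -
    have "T b \<in> nonneg_span S"
    proof (rule obtuse_nonneg_span[OF \<open>finite S\<close> S(4)])
      fix s assume "s \<in> S"
      then obtain b' where "b' \<in> Basis" "s = e b'" using Se by blast
      then show "0 \<le> s \<bullet> T b" using that by (simp add: eT inner_Basis)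
    qed (use span in auto)
    then obtain k where "\<forall>s\<in>S. 0 \<le> k s" "T b = (\<Sum>s\<in>S. k s *\<^sub>R s)" by (auto simp: nonneg_span_def)
    then show ?thesis using that by (auto simp: inner_sum_left intro!: sum_nonneg)
  qed
  show ?thesis
  proof (rule that[of T])
    fix b b' :: 'a assume b: "b \<in> Basis" "b' \<in> Basis"
    show "0 \<le> T b \<bullet> T b'"
    proof (rule nonneg)
      fix s assume "s \<in> S"
      then obtain c where "c \<in> Basis" "s = e c" using Se by blast
      then show "0 \<le> s \<bullet> T b'" using b by (simp add: eT inner_Basis)
    qed (use b in auto)
  next
    fix u b assume "\<forall>a\<in>R. 0 < a \<bullet> w \<longrightarrow> 0 \<le> a \<bullet> u" "b \<in> (Basis :: 'a set)"
    then show "0 \<le> T b \<bullet> u" using S by (intro nonneg) auto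
  next
    fix y
    show "(\<forall>a\<in>R. 0 < a \<bullet> w \<longrightarrow> 0 < a \<bullet> T y) \<longleftrightarrow> (\<forall>b\<in>Basis. 0 < y \<bullet> b)"
    proof
      assume "\<forall>a\<in>R. 0 < a \<bullet> w \<longrightarrow> 0 < a \<bullet> T y"
      then show "\<forall>b\<in>Basis. 0 < y \<bullet> b" using eS eT S by (metis subsetD)
    next
      assume y: "\<forall>b\<in>Basis. 0 < y \<bullet> b"
      show "\<forall>a\<in>R. 0 < a \<bullet> w \<longrightarrow> 0 < a \<bullet> T y"
      proof (intro ballI impI)
        fix a assume a: "a \<in> R" "0 < a \<bullet> w"
        obtain k where k: "\<forall>s\<in>S. 0 \<le> k s" "a = (\<Sum>s\<in>S. k s *\<^sub>R s)"
          using S(3)[OF a] by (auto simp: nonneg_span_def)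
        have "\<exists>s\<in>S. k s \<noteq> 0"
        proof (rule ccontr)
          assume "\<not> ?thesis"
          then have "a = 0" unfolding k(2) by (intro sum.neutral) auto
          then show False using a by simp
        qed
        then obtain s where s: "s \<in> S" "0 < k s" using k(1) by force
        have pos: "0 < s \<bullet> T y" if "s \<in> S" for s using Se[OF that] y eT by auto
        have "a \<bullet> T y = (\<Sum>s\<in>S. k s * (s \<bullet> T y))" by (simp add: k(2) inner_sum_left)
        also have "\<dots> > 0"
          using s k pos \<open>finite S\<close> by (intro sum_pos2[of _ s]) (auto intro!: mult_nonneg_nonneg intro: less_imp_le)
        finally show "0 < a \<bullet> T y" .
      qed
    qed
  qed (use T \<open>bij T\<close> in auto)
qed

section \<open>The Gaussian measure of chambers\<close>

definition gaussian_density :: "'a::euclidean_space \<Rightarrow> real" where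
  "gaussian_density x = 1 / (2 * pi) powr (real DIM('a) / 2) * exp (- (norm x)\<^sup>2 / 2)"

lemma gaussian_density_nonneg: "0 \<le> gaussian_density x"
  by (simp add: gaussian_density_def)

lemma borel_measurable_gaussian_density [measurable]: "gaussian_density \<in> borel_measurable borel"
  unfolding gaussian_density_def[abs_def] by measurable

lemma sets_gaussian_measure [measurable_cong]: "sets gaussian_measure = sets borel"
  by (simp add: gaussian_measure_def)

lemma emeasure_gaussian_measure:
  fixes A :: "'a::euclidean_space set"
  assumes "A \<in> sets borel"
  shows "emeasure gaussian_measure A = (\<integral>\<^sup>+x. ennreal (gaussian_density x) * indicator A x \<partial>lborel)"
  unfolding gaussian_measure_def gaussian_density_def[symmetric]
  using assms by (intro emeasure_density) auto

text \<open>Finiteness is what lets \<open>measure\<close> and \<open>emeasure\<close> be exchanged.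
  The exponential factorises over the coordinates, so integrability in one dimension
  suffices.\<close>

lemma finite_measure_gaussian: "finite_measure (gaussian_measure :: 'a::euclidean_space measure)"
proof
  have one: "(\<integral>\<^sup>+x. ennreal (exp (- x\<^sup>2 / 2)) \<partial>lborel) < \<infinity>"
  proof -
    have "integrable lborel (\<lambda>x. sqrt (2 * pi) * std_normal_density x)"
      by (intro integrable_mult_right integrable_normal_density) auto
    then have "integrable lborel (\<lambda>x::real. exp (- x\<^sup>2 / 2))"
      by (simp add: std_normal_density_def)
    then show ?thesis
      by (subst nn_integral_eq_integral) auto
  qed
  have prod: "ennreal (exp (- (norm x)\<^sup>2 / 2)) = (\<Prod>b\<in>Basis. ennreal (exp (- (x \<bullet> b)\<^sup>2 / 2)))" for x :: 'a
  proof -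
    have "- (norm x)\<^sup>2 / 2 = (\<Sum>b\<in>Basis. - (x \<bullet> b)\<^sup>2 / 2)"
      unfolding power2_norm_eq_inner euclidean_inner[of x x]
      by (simp add: power2_eq_square sum_negf sum_divide_distrib)
    then show ?thesis by (simp add: exp_sum prod_ennreal)
  qed
  have "(\<integral>\<^sup>+x. ennreal (exp (- (norm x)\<^sup>2 / 2)) \<partial>(lborel :: 'a measure)) =
      (\<Prod>b\<in>(Basis :: 'a set). \<integral>\<^sup>+x. ennreal (exp (- x\<^sup>2 / 2)) \<partial>lborel)"
    unfolding prod by (rule nn_integral_lborel_prod) auto
  also have "\<dots> < \<infinity>"
    using one by (simp add: power_less_top_ennreal)
  finally have fin: "(\<integral>\<^sup>+x. ennreal (exp (- (norm x)\<^sup>2 / 2)) \<partial>(lborel :: 'a measure)) < \<infinity>" .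
  have "emeasure gaussian_measure (space (gaussian_measure :: 'a measure)) =
      (\<integral>\<^sup>+x. ennreal (gaussian_density x) \<partial>(lborel :: 'a measure))"
    using emeasure_gaussian_measure[of "UNIV :: 'a set"] by (simp add: gaussian_measure_def)
  also have "\<dots> = ennreal (1 / (2 * pi) powr (real DIM('a) / 2)) *
      (\<integral>\<^sup>+x. ennreal (exp (- (norm x)\<^sup>2 / 2)) \<partial>(lborel :: 'a measure))"
    unfolding gaussian_density_def by (subst nn_integral_cmult[symmetric]) (auto simp flip: ennreal_mult)
  also have "\<dots> < \<infinity>"
    using fin by (simp add: ennreal_mult_less_top)
  finally show "emeasure gaussian_measure (space (gaussian_measure :: 'a measure)) \<noteq> \<infinity>" by simp
qed

lemma emeasure_gaussian_orthogonal_vimage: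
  fixes g :: "'a::euclidean_space \<Rightarrow> 'a"
  assumes g: "orthogonal_transformation g" and [measurable]: "A \<in> sets borel"
  shows "emeasure gaussian_measure (g -` A) = emeasure gaussian_measure A"
proof -
  have [measurable]: "g \<in> borel_measurable borel"
    using g by (intro borel_measurable_continuous_onI linear_continuous_on)
      (simp add: orthogonal_transformation_linear linear_linear)
  have "g -` A \<in> sets borel"
    using measurable_sets_borel[of g borel A] by simp
  then have "emeasure gaussian_measure (g -` A) =
      (\<integral>\<^sup>+x. ennreal (gaussian_density (g x)) * indicator A (g x) \<partial>lborel)"
    using g by (simp add: emeasure_gaussian_measure gaussian_density_def orthogonal_transformation_norm
        indicator_vimage[unfolded comp_def])
  also have "\<dots> = emeasure gaussian_measure A"
    using nn_integral_orthogonal_substitution[OF g, of "\<lambda>x. ennreal (gaussian_density x) * indicator A x"]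
    by (simp add: emeasure_gaussian_measure)
  finally show ?thesis .
qed

section \<open>Support functions and the Hoelder estimate\<close>

lemma support_function_orthogonal:
  assumes "orthogonal_transformation g" "g ` K = K"
  shows "support_function K (g u) = support_function K u"
proof -
  have "(\<lambda>y. g u \<bullet> y) ` K = (\<lambda>y. g u \<bullet> y) ` (g ` K)" using assms by simp
  also have "\<dots> = (\<lambda>y. u \<bullet> y) ` K"
    using assms(1) by (simp add: image_image orthogonal_transformation_def)
  finally show ?thesis by (simp add: support_function_def)
qed

lemma support_function_upper:
  assumes "bounded K" "y \<in> K"
  shows "u \<bullet> y \<le> support_function K u"
proof -
  have "bdd_above ((\<lambda>y. u \<bullet> y) ` K)"
    using assms(1) by (intro bounded_imp_bdd_above bounded_linear_image bounded_linear_inner_right)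
  then show ?thesis unfolding support_function_def using assms(2) by (rule cSUP_upper2) auto
qed

lemma closed_L0_sum: "closed (L0_sum t K L)"
proof -
  have "L0_sum t K L = (\<Inter>u\<in>sphere 0 1. {x. u \<bullet> x \<le> support_function K u powr (1 - t) * support_function L u powr t})"
    by (auto simp: L0_sum_def inner_commute)
  then show ?thesis by (auto intro!: closed_halfspace_le)
qed

text \<open>AM-GM is applied to \<open>y i / Y\<close> and \<open>z i / Z\<close>, where
  \<open>Y\<close> and \<open>Z\<close> are the weighted sums; summing against \<open>d\<close>
  turns both normalised sums into 1.\<close>

lemma sum_geometric_mean_le:
  fixes y z d :: "'i \<Rightarrow> real"
  assumes t: "0 < t" "t < 1" and "finite I"
    and y: "\<And>i. i \<in> I \<Longrightarrow> 0 < y i" and z: "\<And>i. i \<in> I \<Longrightarrow> 0 < z i" and d: "\<And>i. i \<in> I \<Longrightarrow> 0 \<le> d i"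
  shows "(\<Sum>i\<in>I. (y i powr (1 - t) * z i powr t) * d i) \<le>
    (\<Sum>i\<in>I. y i * d i) powr (1 - t) * (\<Sum>i\<in>I. z i * d i) powr t"
\<comment> \<open>Vanishing weights would make \<open>Y\<close> and \<open>Z\<close> zero; in the
  other case both are positive and may be divided by.\<close>
proof (cases "\<forall>i\<in>I. d i = 0")
  case True
  then show ?thesis by simp
next
  case False
  then obtain j where j: "j \<in> I" "0 < d j" using d by force
  define Y Z where "Y = (\<Sum>i\<in>I. y i * d i)" and "Z = (\<Sum>i\<in>I. z i * d i)"
  have Y: "0 < Y" and Z: "0 < Z" unfolding Y_def Z_def
    using j y z d \<open>finite I\<close>
    by (auto intro!: sum_pos2[of _ j] mult_nonneg_nonneg intro: less_imp_le)
  have "(\<Sum>i\<in>I. (y i powr (1 - t) * z i powr t) * d i) \<le>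
      (\<Sum>i\<in>I. Y powr (1 - t) * Z powr t * ((1 - t) * (y i * d i / Y) + t * (z i * d i / Z)))"
  proof (rule sum_mono)
    fix i assume i: "i \<in> I"
    have "y i powr (1 - t) * z i powr t = Y powr (1 - t) * Z powr t * ((y i / Y) powr (1 - t) * (z i / Z) powr t)"
      using y[OF i] z[OF i] Y Z by (simp add: powr_divide)
    also have "\<dots> \<le> Y powr (1 - t) * Z powr t * ((1 - t) * (y i / Y) + t * (z i / Z))"
      using y[OF i] z[OF i] Y Z t by (intro mult_left_mono weighted_am_gm) auto
    finally have "(y i powr (1 - t) * z i powr t) * d i \<le>
        Y powr (1 - t) * Z powr t * ((1 - t) * (y i / Y) + t * (z i / Z)) * d i"
      using d[OF i] by (rule mult_right_mono)
    then show "(y i powr (1 - t) * z i powr t) * d i \<le>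
        Y powr (1 - t) * Z powr t * ((1 - t) * (y i * d i / Y) + t * (z i * d i / Z))"
      by (simp add: algebra_simps)
  qed
  also have "\<dots> = Y powr (1 - t) * Z powr t * ((1 - t) * (Y / Y) + t * (Z / Z))"
    by (simp add: sum_distrib_left[symmetric] sum.distrib sum_divide_distrib[symmetric] Y_def[symmetric] Z_def[symmetric]
        del: divide_self_if)
  also have "\<dots> = Y powr (1 - t) * Z powr t" using Y Z by simp
  finally show ?thesis by (simp add: Y_def Z_def)
qed

section \<open>Chambers\<close>

text \<open>When \<open>R\<close> is finite and symmetric and no root is orthogonal to
  \<open>w\<close>, this is the component of \<open>w\<close> in the complement of the mirrors.
  Every root then counts, through itself or its negative.\<close>

definition chamber :: "'a::real_inner set \<Rightarrow> 'a \<Rightarrow> 'a set" where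
  "chamber R w = {x. \<forall>a\<in>R. 0 < a \<bullet> w \<longrightarrow> 0 < a \<bullet> x}"

lemma open_chamber:
  assumes "finite R"
  shows "open (chamber R w)"
proof -
  have "chamber R w = (\<Inter>a\<in>{a\<in>R. 0 < a \<bullet> w}. {x. a \<bullet> x > 0})"
    by (auto simp: chamber_def)
  then show ?thesis using assms by (auto intro!: open_INT open_halfspace_gt)
qed

lemma chamber_measurable [measurable]: "finite R \<Longrightarrow> chamber (R :: 'a::euclidean_space set) w \<in> sets borel"
  by (intro borel_open open_chamber)

text \<open>\<open>F S\<close> is the Gaussian density restricted to \<open>S\<close> and the
  chamber, pulled back to the orthant by \<open>T\<close> and multiplied by the Jacobian
  \<open>c\<close>. Two facts about the geometric mean \<open>x\<close> supply the Prekopa-Leindler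
  hypothesis: \<open>T x\<close> lies in the \<open>L0_sum\<close>, and \<open>norm (T x)\<close> is
  small enough.\<close>

lemma chamber_inequality:
  fixes R K L :: "'a::euclidean_space set"
  assumes t: "0 < t" "t < 1"
    and R: "unit_root_system R" "finite R" "span R = UNIV" and w: "\<And>a. a \<in> R \<Longrightarrow> a \<bullet> w \<noteq> 0"
    and K: "compact K" "\<And>a. a \<in> R \<Longrightarrow> reflect a ` K = K"
    and L: "compact L" "\<And>a. a \<in> R \<Longrightarrow> reflect a ` L = L"
  shows "measure gaussian_measure (K \<inter> chamber R w) powr (1 - t) * measure gaussian_measure (L \<inter> chamber R w) powr t
    \<le> measure gaussian_measure (L0_sum t K L \<inter> chamber R w)"
proof -
  interpret finite_measure "gaussian_measure :: 'a measure" by (rule finite_measure_gaussian)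
  let ?C = "chamber R w"
  let ?M = "L0_sum t K L"
  obtain T :: "'a \<Rightarrow> 'a" where T: "linear T" "bij T"
    and TC: "\<And>y. (\<forall>a\<in>R. 0 < a \<bullet> w \<longrightarrow> 0 < a \<bullet> T y) \<longleftrightarrow> (\<forall>b\<in>Basis. 0 < y \<bullet> b)"
    and Tacute: "\<And>b b'. b \<in> Basis \<Longrightarrow> b' \<in> Basis \<Longrightarrow> 0 \<le> T b \<bullet> T b'"
    and Tdual: "\<And>u b. (\<forall>a\<in>R. 0 < a \<bullet> w \<longrightarrow> 0 \<le> a \<bullet> u) \<Longrightarrow> b \<in> Basis \<Longrightarrow> 0 \<le> T b \<bullet> u"
  proof (rule chamber_coordinates[OF R, of w], goal_cases)
    case (2 T)
    show ?case by (rule that[of T]) (fact 2)+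
  qed (rule w)
  obtain c where "0 < c" and c: "\<And>F :: 'a \<Rightarrow> ennreal. F \<in> borel_measurable borel \<Longrightarrow>
      (\<integral>\<^sup>+x. F x \<partial>lborel) = ennreal c * (\<integral>\<^sup>+x. F (T x) \<partial>lborel)"
  proof (rule nn_integral_linear_substitution_ex[OF T], goal_cases)
    case (1 c)
    show ?case by (rule that[of c]) (fact 1)+
  qed
  have [measurable]: "T \<in> borel_measurable borel"
    using T by (intro borel_measurable_continuous_onI linear_continuous_on) (simp add: linear_linear)
  have [measurable]: "K \<in> sets borel" "L \<in> sets borel" "?M \<in> sets borel" "?C \<in> sets borel"
    using K L R by (auto intro: borel_compact borel_closed[OF closed_L0_sum] chamber_measurable)
  have Tsum: "T y = (\<Sum>b\<in>Basis. (y \<bullet> b) *\<^sub>R T b)" for y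
    by (subst euclidean_representation[of y, symmetric])
      (simp add: linear_sum[OF T(1)] linear_cmul[OF T(1)] del: euclidean_representation)
  have TC': "T y \<in> ?C \<longleftrightarrow> (\<forall>b\<in>Basis. 0 < y \<bullet> b)" for y
    using TC by (simp add: chamber_def)
  have inv: "reflect a ` S = S" if "a \<in> R" "S \<in> {K, L}" for a S
    using K(2)[OF that(1)] L(2)[OF that(1)] that(2) by (elim insertE) simp_all
  define F where "F S y = ennreal (c * gaussian_density (T y)) * indicator (S \<inter> ?C) (T y)" for S y
  have F: "(\<integral>\<^sup>+y. F S y \<partial>lborel) = ennreal (measure gaussian_measure (S \<inter> ?C))"
    if [measurable]: "S \<in> sets borel" for S
  proof -
    have "ennreal (measure gaussian_measure (S \<inter> ?C)) =
        ennreal c * (\<integral>\<^sup>+y. ennreal (gaussian_density (T y)) * indicator (S \<inter> ?C) (T y) \<partial>lborel)"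
      unfolding emeasure_eq_measure[symmetric]
      by (subst emeasure_gaussian_measure, measurable, rule c) measurable
    also have "\<dots> = (\<integral>\<^sup>+y. F S y \<partial>lborel)"
      unfolding F_def using \<open>0 < c\<close>
      by (subst nn_integral_cmult[symmetric]) (auto simp: ennreal_mult gaussian_density_nonneg mult.assoc)
    finally show ?thesis by simp
  qed
  have Fmeas [measurable]: "F S \<in> borel_measurable borel" if [measurable]: "S \<in> sets borel" for S
    unfolding F_def[abs_def] by measurable
  have FD: "T y \<in> S" "T y \<in> ?C" "p \<le> c * gaussian_density (T y)" if "ennreal p \<le> F S y" "0 < p" for S y p
  proof -
    have "T y \<in> S \<inter> ?C"
      using that by (cases "T y \<in> S \<inter> ?C") (auto simp: F_def)
    then show "T y \<in> S" "T y \<in> ?C" "p \<le> c * gaussian_density (T y)"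
      using that \<open>0 < c\<close> by (auto simp: F_def gaussian_density_nonneg)
  qed
  \<comment> \<open>The measures of the two pieces serve as \<open>p\<close> and \<open>q\<close>,
    which have to be positive; if one vanishes, the left side is 0.\<close>
  show ?thesis
  proof (cases "measure gaussian_measure (K \<inter> ?C) = 0 \<or> measure gaussian_measure (L \<inter> ?C) = 0")
    case True
    then show ?thesis by auto
  next
    case False
    have "ennreal (measure gaussian_measure (K \<inter> ?C) powr (1 - t) * measure gaussian_measure (L \<inter> ?C) powr t)
      \<le> (\<integral>\<^sup>+y. F ?M y \<partial>lborel)"
    proof (rule prekopa_leindler_orthant[OF t, of "F K" "F L"])
      fix x b :: 'a assume "F K x \<noteq> 0" "b \<in> Basis"
      then show "0 < x \<bullet> b" using TC' by (auto simp: F_def indicator_def split: if_splits)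
    next
      fix x b :: 'a assume "F L x \<noteq> 0" "b \<in> Basis"
      then show "0 < x \<bullet> b" using TC' by (auto simp: F_def indicator_def split: if_splits)
    next
      fix y z :: 'a and p q :: real
      assume p: "0 < p" "0 < q" "ennreal p \<le> F K y" "ennreal q \<le> F L z"
      define x where "x = (\<Sum>b\<in>Basis. ((y \<bullet> b) powr (1 - t) * (z \<bullet> b) powr t) *\<^sub>R b)"
      have xb: "x \<bullet> b = (y \<bullet> b) powr (1 - t) * (z \<bullet> b) powr t" if "b \<in> Basis" for b
        using that by (simp add: x_def)
      have y: "T y \<in> K" "T y \<in> ?C" "p \<le> c * gaussian_density (T y)" using FD p by blast+
      have z: "T z \<in> L" "T z \<in> ?C" "q \<le> c * gaussian_density (T z)" using FD p by blast+
      have yb: "0 < y \<bullet> b" and zb: "0 < z \<bullet> b" if "b \<in> Basis" for b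
        using y z that TC' by blast+
      have xC: "T x \<in> ?C"
        unfolding TC'
      proof
        fix b :: 'a assume "b \<in> Basis"
        then show "0 < x \<bullet> b" using yb[of b] zb[of b] by (simp add: xb)
      qed
      have "T x \<in> ?M"
        unfolding L0_sum_def
      proof (intro CollectI ballI)
        fix u :: 'a
        \<comment> \<open>Replacing \<open>u\<close> by \<open>g u\<close> does not decrease the
          inner product with \<open>T x\<close> and leaves both support functions unchanged. As
          \<open>T x\<close> lies in the chamber, \<open>g u\<close> pairs nonnegatively with every
          ray \<open>T b\<close>, so the weights in the Hoelder estimate are nonnegative.\<close>
        obtain g where g: "g \<in> root_symmetries R {K, L}" "T x \<bullet> u \<le> T x \<bullet> g u"
          and dom: "\<And>a. a \<in> R \<Longrightarrow> 0 < a \<bullet> T x \<Longrightarrow> 0 \<le> a \<bullet> g u"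
        proof (rule root_symmetries_dominant[OF R, of "{K, L}" "T x" u], goal_cases)
          case (2 g)
          show ?case by (rule that[of g]) (fact 2)+
        qed (rule inv)
        have g': "orthogonal_transformation g" "g ` K = K" "g ` L = L"
          using g by (auto simp: root_symmetries_def)
        have d: "0 \<le> T b \<bullet> g u" if "b \<in> Basis" for b
          using that xC by (intro Tdual ballI impI dom) (auto simp: chamber_def)
        have inner: "T v \<bullet> g u = (\<Sum>b\<in>Basis. (v \<bullet> b) * (T b \<bullet> g u))" for v
          unfolding Tsum[of v] by (simp add: inner_sum_left)
        have le: "T y \<bullet> g u \<le> support_function K u" "T z \<bullet> g u \<le> support_function L u"
          using support_function_upper[of K "T y" "g u"] support_function_upper[of L "T z" "g u"] y z K L g'
          by (auto simp: support_function_orthogonal compact_imp_bounded inner_commute)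
        \<comment> \<open>\<open>powr\<close> is monotone in its base only from 0 on.\<close>
        have ge: "0 \<le> T y \<bullet> g u" "0 \<le> T z \<bullet> g u"
          unfolding inner[of y] inner[of z] using d yb zb by (auto intro!: sum_nonneg mult_nonneg_nonneg intro: less_imp_le)
        have "T x \<bullet> u \<le> T x \<bullet> g u" by (rule g)
        also have "\<dots> \<le> (T y \<bullet> g u) powr (1 - t) * (T z \<bullet> g u) powr t"
          unfolding inner[of x] inner[of y] inner[of z] using sum_geometric_mean_le[OF t finite_Basis yb zb d] by (simp add: xb cong: sum.cong)
        also have "\<dots> \<le> support_function K u powr (1 - t) * support_function L u powr t"
          using le ge t by (intro mult_mono powr_mono2) auto
        finally show "T x \<bullet> u \<le> support_function K u powr (1 - t) * support_function L u powr t" .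
      qed
      have norm: "(norm (T v))\<^sup>2 = (\<Sum>b\<in>Basis. \<Sum>b'\<in>Basis. (v \<bullet> b) * (v \<bullet> b') * (T b \<bullet> T b'))" for v
        unfolding power2_norm_eq_inner Tsum[of v]
        by (simp add: inner_sum_left inner_sum_right sum_distrib_left mult.assoc mult.left_commute)
          (simp add: inner_commute)
      have "(norm (T x))\<^sup>2 \<le> (\<Sum>b\<in>Basis. \<Sum>b'\<in>Basis.
          ((1 - t) * ((y \<bullet> b) * (y \<bullet> b')) + t * ((z \<bullet> b) * (z \<bullet> b'))) * (T b \<bullet> T b'))"
        unfolding norm
      proof (intro sum_mono mult_right_mono Tacute)
        fix b b' :: 'a assume b: "b \<in> Basis" "b' \<in> Basis"
        have "(x \<bullet> b) * (x \<bullet> b') = ((y \<bullet> b) * (y \<bullet> b')) powr (1 - t) * ((z \<bullet> b) * (z \<bullet> b')) powr t"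
          using yb zb b by (simp add: xb powr_mult less_imp_le)
        also have "\<dots> \<le> (1 - t) * ((y \<bullet> b) * (y \<bullet> b')) + t * ((z \<bullet> b) * (z \<bullet> b'))"
          using yb zb b t by (intro weighted_am_gm) auto
        finally show "(x \<bullet> b) * (x \<bullet> b') \<le> (1 - t) * ((y \<bullet> b) * (y \<bullet> b')) + t * ((z \<bullet> b) * (z \<bullet> b'))" .
      qed
      also have "\<dots> = (1 - t) * (norm (T y))\<^sup>2 + t * (norm (T z))\<^sup>2"
        unfolding norm by (simp add: sum_distrib_left sum.distrib distrib_right mult.assoc)
      finally have normle: "(norm (T x))\<^sup>2 \<le> (1 - t) * (norm (T y))\<^sup>2 + t * (norm (T z))\<^sup>2" .
      \<comment> \<open>\<open>\<kappa>\<close> merges the Jacobian with the normalising constant,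
        so one use of homogeneity extracts both.\<close>
      define \<kappa> where "\<kappa> = c * (1 / (2 * pi) powr (real DIM('a) / 2))"
      have "0 < \<kappa>" using \<open>0 < c\<close> by (simp add: \<kappa>_def)
      have dens: "c * gaussian_density v = \<kappa> * exp (- (norm v)\<^sup>2 / 2)" for v :: 'a
        by (simp add: gaussian_density_def \<kappa>_def)
      have "p powr (1 - t) * q powr t \<le>
          (\<kappa> * exp (- (norm (T y))\<^sup>2 / 2)) powr (1 - t) * (\<kappa> * exp (- (norm (T z))\<^sup>2 / 2)) powr t"
        using y z p t unfolding dens by (intro mult_mono powr_mono2) auto
      also have "\<dots> = \<kappa> * (exp (- (norm (T y))\<^sup>2 / 2) powr (1 - t) * exp (- (norm (T z))\<^sup>2 / 2) powr t)"
        using \<open>0 < \<kappa>\<close> by (rule powr_mult_scale)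
      also have "\<dots> = \<kappa> * exp (- ((1 - t) * (norm (T y))\<^sup>2 + t * (norm (T z))\<^sup>2) / 2)"
        by (simp add: powr_def flip: exp_add)
      also have "\<dots> \<le> \<kappa> * exp (- (norm (T x))\<^sup>2 / 2)"
        using normle \<open>0 < \<kappa>\<close> by (intro mult_left_mono) auto
      finally have "ennreal (p powr (1 - t) * q powr t) \<le> ennreal (c * gaussian_density (T x))"
        unfolding dens by (rule ennreal_leI)
      then show "ennreal (p powr (1 - t) * q powr t) \<le> F ?M (\<Sum>b\<in>Basis. ((y \<bullet> b) powr (1 - t) * (z \<bullet> b) powr t) *\<^sub>R b)"
        unfolding x_def[symmetric] using \<open>T x \<in> ?M\<close> xC by (simp add: F_def)
    next
      show "0 < measure gaussian_measure (K \<inter> ?C)" "0 < measure gaussian_measure (L \<inter> ?C)"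
        using False by (auto simp: zero_less_measure_iff)
    qed (auto simp: F)
    then show ?thesis by (simp add: F)
  qed
qed

text \<open>Some symmetry \<open>g\<close> makes \<open>g w'\<close> dominant with respect to
  \<open>w\<close>. No root is orthogonal to \<open>g w'\<close>, so it has the signs of
  \<open>w\<close> on all roots, and the preimage of \<open>chamber R w\<close> under
  \<open>g\<close> is \<open>chamber R w'\<close>. Both \<open>K\<close> and the Gaussian measure
  are preserved by \<open>g\<close>.\<close>

lemma measure_chamber_eq:
  fixes R K :: "'a::euclidean_space set"
  assumes R: "unit_root_system R" "finite R" "span R = UNIV"
    and w: "\<And>a. a \<in> R \<Longrightarrow> a \<bullet> w \<noteq> 0" and w': "\<And>a. a \<in> R \<Longrightarrow> a \<bullet> w' \<noteq> 0"
    and K: "K \<in> sets borel" "\<And>a. a \<in> R \<Longrightarrow> reflect a ` K = K"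
  shows "measure gaussian_measure (K \<inter> chamber R w') = measure gaussian_measure (K \<inter> chamber R w)"
proof -
  have inv: "reflect a ` S = S" if "a \<in> R" "S \<in> {K}" for a S
    using K that by simp
  obtain g where g: "g \<in> root_symmetries R {K}" "w \<bullet> w' \<le> w \<bullet> g w'" and dom: "\<And>a. a \<in> R \<Longrightarrow> 0 < a \<bullet> w \<Longrightarrow> 0 \<le> a \<bullet> g w'"
  proof (rule root_symmetries_dominant[OF R, of "{K}" w w'], goal_cases)
    case (2 g)
    show ?case by (rule that[of g]) (fact 2)+
  qed (rule inv)
  have g': "orthogonal_transformation g" "g ` R = R" "g ` K = K"
    using g by (auto simp: root_symmetries_def)
  have gg: "g x \<bullet> g y = x \<bullet> y" for x y using g'(1) by (simp add: orthogonal_transformation_def)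
  have reg: "a \<bullet> g w' \<noteq> 0" if "a \<in> R" for a
    using that w' gg g'(2) by (metis imageE)
  \<comment> \<open>Dominance is applied to \<open>a\<close> and to \<open>- a\<close>; regularity
    of both vectors makes the inequalities strict.\<close>
  have sign: "0 < a \<bullet> g w' \<longleftrightarrow> 0 < a \<bullet> w" if "a \<in> R" for a
    using dom[OF that] dom[OF unit_root_systemD(3)[OF R(1) that]] reg[OF that] w[OF that]
    by (smt (verit) inner_minus_left)
  have "x \<in> chamber R w' \<longleftrightarrow> g x \<in> chamber R w" for x
  proof -
    have "g x \<in> chamber R w \<longleftrightarrow> (\<forall>a\<in>g ` R. 0 < a \<bullet> g w' \<longrightarrow> 0 < a \<bullet> g x)"
      using sign g'(2) by (simp add: chamber_def)
    then show ?thesis by (simp add: chamber_def gg)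
  qed
  moreover have "x \<in> K \<longleftrightarrow> g x \<in> K" for x
    using g'(3) orthogonal_transformation_inj[OF g'(1)] by (metis inj_image_mem_iff)
  ultimately have "K \<inter> chamber R w' = g -` (K \<inter> chamber R w)" by auto
  then show ?thesis
    using emeasure_gaussian_orthogonal_vimage[OF g'(1), of "K \<inter> chamber R w"] K R
    by (simp add: measure_def sets.Int)
qed

text \<open>A chamber is determined by the roots positive on it, so there are finitely many. It
  equals the chamber of each of its points, so distinct chambers are disjoint; together they miss
  only points on finitely many hyperplanes, a null set.\<close>

lemma gaussian_measure_chambers:
  fixes R K :: "'a::euclidean_space set"
  assumes R: "finite R" "0 \<notin> R" and K: "K \<in> sets borel"
  defines "\<C> \<equiv> chamber R ` {w. \<forall>a\<in>R. a \<bullet> w \<noteq> 0}"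
  assumes sym: "\<And>a. a \<in> R \<Longrightarrow> - a \<in> R"
  shows "finite \<C>" "measure gaussian_measure K = (\<Sum>C\<in>\<C>. measure gaussian_measure (K \<inter> C))"
proof -
  interpret finite_measure "gaussian_measure :: 'a measure" by (rule finite_measure_gaussian)
  have "\<C> \<subseteq> (\<lambda>P. {x. \<forall>a\<in>P. 0 < a \<bullet> x}) ` Pow R"
    unfolding \<C>_def chamber_def by (auto intro!: image_eqI[of _ _ "{a\<in>R. 0 < a \<bullet> w}" for w])
  then show fin: "finite \<C>" using R by (meson finite_Pow_iff finite_imageI finite_subset)
  have eq: "chamber R w = chamber R x" if "\<forall>a\<in>R. a \<bullet> w \<noteq> 0" "x \<in> chamber R w" for w x
  proof -
    have "0 < a \<bullet> w \<longleftrightarrow> 0 < a \<bullet> x" if "a \<in> R" for a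
      using \<open>x \<in> chamber R w\<close> \<open>\<forall>a\<in>R. a \<bullet> w \<noteq> 0\<close> that sym[OF that]
      by (force simp: chamber_def inner_minus_left)
    then show ?thesis by (auto simp: chamber_def)
  qed
  have self: "x \<in> chamber R x" for x by (simp add: chamber_def)
  have disj: "disjoint_family_on (\<lambda>C. K \<inter> C) \<C>"
    unfolding disjoint_family_on_def \<C>_def using eq by blast
  have meas: "(\<lambda>C. K \<inter> C) ` \<C> \<subseteq> sets gaussian_measure"
    unfolding \<C>_def sets_gaussian_measure using K R chamber_measurable by blast
  have "AE x in lborel. \<forall>a\<in>R. a \<bullet> x \<noteq> 0"
  proof (subst AE_ball_countable)
    show "countable R" using R(1) by (rule countable_finite)
    show "\<forall>a\<in>R. AE x in lborel. a \<bullet> x \<noteq> 0"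
    proof
      fix a assume "a \<in> R"
      then have "negligible {x. a \<bullet> x = 0}" using R by (intro negligible_hyperplane) auto
      then have "{x. a \<bullet> x = 0} \<in> null_sets lborel"
        by (simp add: negligible_iff_null_sets null_sets_completion_iff closed_hyperplane borel_closed)
      from AE_not_in[OF this] show "AE x in lborel. a \<bullet> x \<noteq> 0" by simp
    qed
  qed
  then have ae: "AE x in gaussian_measure. \<forall>a\<in>R. a \<bullet> x \<noteq> 0"
    unfolding gaussian_measure_def by (subst AE_density) (auto elim: eventually_mono)
  have "measure gaussian_measure K = measure gaussian_measure (\<Union>C\<in>\<C>. K \<inter> C)"
  proof (rule finite_measure_eq_AE)
    show "AE x in gaussian_measure. x \<in> K \<longleftrightarrow> x \<in> (\<Union>C\<in>\<C>. K \<inter> C)"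
      using ae by eventually_elim (use self in \<open>auto simp: \<C>_def\<close>)
    show "(\<Union>C\<in>\<C>. K \<inter> C) \<in> sets gaussian_measure"
      using meas fin by (intro sets.finite_UN) auto
  qed (use K in \<open>simp add: sets_gaussian_measure\<close>)
  also have "\<dots> = (\<Sum>C\<in>\<C>. measure gaussian_measure (K \<inter> C))"
    by (rule finite_measure_finite_Union[OF fin meas disj])
  finally show "measure gaussian_measure K = (\<Sum>C\<in>\<C>. measure gaussian_measure (K \<inter> C))" .
qed

text \<open>All chambers hold equal shares of \<open>K\<close> and equal shares of \<open>L\<close>,
  so by homogeneity the geometric mean of the totals is the sum of the chamberwise geometric means.
  For the \<open>L0_sum\<close>, additivity over chambers is enough.\<close>

lemma gaussian_log_brunn_minkowski_root_system:
  fixes R K L :: "'a::euclidean_space set"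
  assumes t: "0 < t" "t < 1"
    and R: "unit_root_system R" "finite R" "span R = UNIV"
    and K: "compact K" "\<And>a. a \<in> R \<Longrightarrow> reflect a ` K = K"
    and L: "compact L" "\<And>a. a \<in> R \<Longrightarrow> reflect a ` L = L"
  shows "measure gaussian_measure K powr (1 - t) * measure gaussian_measure L powr t
    \<le> measure gaussian_measure (L0_sum t K L)"
proof -
  define \<C> where "\<C> = chamber R ` {w. \<forall>a\<in>R. a \<bullet> w \<noteq> 0}"
  have R0: "0 \<notin> R" using unit_root_systemD(1)[OF R(1)] by force
  have sum: "finite \<C>" "measure gaussian_measure S = (\<Sum>C\<in>\<C>. measure gaussian_measure (S \<inter> C))"
    if "S \<in> sets borel" for S
    using gaussian_measure_chambers[OF R(2) R0 that] unit_root_systemD(3)[OF R(1)] unfolding \<C>_def by blast+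
  have meas: "K \<in> sets borel" "L \<in> sets borel" "L0_sum t K L \<in> sets borel"
    using K L by (auto intro: borel_compact borel_closed[OF closed_L0_sum])
  show ?thesis
  \<comment> \<open>Without chambers the decomposition would give \<open>K\<close> measure 0, and
    the left side vanishes.\<close>
  proof (cases "\<C> = {}")
    case True
    then show ?thesis using sum(2)[OF meas(1)] by simp
  next
    case False
    then obtain w where w: "\<And>a. a \<in> R \<Longrightarrow> a \<bullet> w \<noteq> 0" by (auto simp: \<C>_def)
    define n where "n = real (card \<C>)"
    have "0 < n" using False sum(1)[OF meas(1)] by (simp add: n_def card_gt_0_iff)
    have const: "measure gaussian_measure (S \<inter> C) = measure gaussian_measure (S \<inter> chamber R w)"
      if "S \<in> sets borel" "\<And>a. a \<in> R \<Longrightarrow> reflect a ` S = S" "C \<in> \<C>" for S C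
      using that measure_chamber_eq[OF R w _ that(1,2)] by (auto simp: \<C>_def)
    let ?k = "measure gaussian_measure (K \<inter> chamber R w)"
    let ?l = "measure gaussian_measure (L \<inter> chamber R w)"
    have k: "measure gaussian_measure K = n * ?k"
      using sum(2)[OF meas(1)] const[OF meas(1) K(2)] by (simp add: n_def)
    have l: "measure gaussian_measure L = n * ?l"
      using sum(2)[OF meas(2)] const[OF meas(2) L(2)] by (simp add: n_def)
    have "measure gaussian_measure K powr (1 - t) * measure gaussian_measure L powr t = n * (?k powr (1 - t) * ?l powr t)"
      unfolding k l using \<open>0 < n\<close> by (rule powr_mult_scale)
    also have "\<dots> = (\<Sum>C\<in>\<C>. measure gaussian_measure (K \<inter> C) powr (1 - t) * measure gaussian_measure (L \<inter> C) powr t)"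
      using const[OF meas(1) K(2)] const[OF meas(2) L(2)] by (simp add: n_def)
    also have "\<dots> \<le> (\<Sum>C\<in>\<C>. measure gaussian_measure (L0_sum t K L \<inter> C))"
      unfolding \<C>_def by (intro sum_mono) (use chamber_inequality[OF t R _ K L] in auto)
    also have "\<dots> = measure gaussian_measure (L0_sum t K L)"
      by (rule sum(2)[OF meas(3), symmetric])
    finally show ?thesis .
  qed
qed

section \<open>The roots of two invariant bodies\<close>

lemma reflect_image_eq_iff:
  assumes "norm a = 1"
  shows "reflect a ` K = K \<longleftrightarrow> (\<forall>x\<in>K. reflect a x \<in> K)"
  using reflect_involution[OF assms] by (metis image_subset_iff image_eqI subsetI subset_antisym)

lemma unit_root_system_of_reflections:
  "unit_root_system {a. norm a = 1 \<and> (\<forall>S\<in>\<S>. reflect a ` S = S)}"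
proof -
  have "reflect (reflect a b) ` S = S"
    if "norm a = 1" "reflect a ` S = S" "reflect b ` S = S" for a b and S :: "'a set"
  proof -
    have "reflect (reflect a b) ` S = reflect a ` reflect b ` reflect a ` S"
      by (simp add: image_image reflect_reflect[OF that(1)])
    then show ?thesis using that by simp
  qed
  moreover have "norm (reflect a b) = norm b" if "norm a = 1" for a b :: 'a
    using inner_reflect_reflect[OF that, of b b] by (simp add: norm_eq_sqrt_inner)
  ultimately show ?thesis by (auto simp: unit_root_system_def)
qed

text \<open>Reflections are involutions, so invariance of \<open>S\<close> amounts to the conditions
  \<open>reflect a x \<in> S\<close> for \<open>x \<in> S\<close>, each of which is closed in
  \<open>a\<close>.\<close>

lemma closed_roots_of_reflections:
  fixes \<S> :: "'a::euclidean_space set set"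
  assumes "\<And>S. S \<in> \<S> \<Longrightarrow> closed S"
  shows "closed {a. norm a = 1 \<and> (\<forall>S\<in>\<S>. reflect a ` S = S)}"
proof -
  have "{a. norm a = 1 \<and> (\<forall>S\<in>\<S>. reflect a ` S = S)} =
      sphere 0 1 \<inter> (\<Inter>S\<in>\<S>. \<Inter>x\<in>S. (\<lambda>a. reflect a x) -` S)"
    using reflect_image_eq_iff by fastforce
  moreover have "continuous_on UNIV (\<lambda>a. reflect a x)" for x :: 'a
    unfolding reflect_def by (intro continuous_intros)
  ultimately show ?thesis
    using assms by (auto intro!: closed_Int closed_INT closed_vimage)
qed

lemma linear_hyperplane_unit_normal:
  assumes "linear_hyperplane H"
  obtains a where "norm a = 1" "H = {x. a \<bullet> x = 0}" "orthogonal_reflection H = reflect a"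
proof -
  have "span H = H" using assms by (simp add: linear_hyperplane_def)
  moreover obtain b where "b \<noteq> 0" "span H = {x. b \<bullet> x = 0}"
    using assms dim_eq_hyperplane[of H] by (auto simp: linear_hyperplane_def)
  ultimately have b: "b \<noteq> 0" "H = {x. b \<bullet> x = 0}"
    by simp_all
  define a where "a = b /\<^sub>R norm b"
  have "norm a = 1" using b by (simp add: a_def)
  moreover have H: "H = {x. a \<bullet> x = 0}" using b by (simp add: a_def)
  moreover have "orthogonal_reflection H = reflect a"
  proof
    have "a \<noteq> 0" using \<open>norm a = 1\<close> by auto
    then show "orthogonal_reflection H x = reflect a x" for x
      unfolding H using \<open>norm a = 1\<close>
      by (simp add: orthogonal_reflection_hyperplane reflect_def dot_square_norm)
  qed
  ultimately show ?thesis by (rule that)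
qed

theorem theorem4:
  fixes H :: "'n::finite \<Rightarrow> (real ^ 'n) set"
    and K L :: "(real ^ 'n) set"
    and t :: real
  assumes "0 < t" and "t < 1"
    and "\<And>i. linear_hyperplane (H i)"
    and "(\<Inter>i. H i) = {0}"
    and "convex_body K" and "convex_body L"
    and "\<And>i. invariant_under (orthogonal_reflection (H i)) K"
    and "\<And>i. invariant_under (orthogonal_reflection (H i)) L"
  shows "measure gaussian_measure (L0_sum t K L)
           \<ge> measure gaussian_measure K powr (1 - t) * measure gaussian_measure L powr t"
proof -
  have cpt: "compact K" "compact L" using assms by (auto simp: convex_body_def)
  define R where "R = {a. norm a = 1 \<and> (\<forall>S\<in>{K, L}. reflect a ` S = S)}"
  have "unit_root_system R" unfolding R_def by (rule unit_root_system_of_reflections)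
  moreover have "closed R"
    unfolding R_def using cpt by (intro closed_roots_of_reflections) (auto intro: compact_imp_closed)
  ultimately obtain S where S: "S \<subseteq> R" "finite S" "unit_root_system S" "R \<subseteq> span S"
    using finite_unit_root_subsystem by blast
  \<comment> \<open>A nonzero vector orthogonal to all roots would lie in every \<open>H i\<close>,
    because each \<open>H i\<close> has a unit normal among the roots.\<close>
  have "span R = UNIV"
  proof (rule ccontr)
    assume "span R \<noteq> UNIV"
    then obtain z where z: "z \<noteq> 0" "\<And>a. a \<in> span R \<Longrightarrow> z \<bullet> a = 0"
      using span_not_UNIV_orthogonal by blast
    have "z \<in> H i" for i
    proof -
      obtain a where a: "norm a = 1" "H i = {x. a \<bullet> x = 0}" "orthogonal_reflection (H i) = reflect a"
        using linear_hyperplane_unit_normal[OF assms(3)] by blast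
      then have "a \<in> R"
        using assms(7,8)[of i] by (simp add: R_def invariant_under_def)
      then show ?thesis using z(2)[OF span_base] a by (simp add: inner_commute)
    qed
    then show False using assms(4) z(1) by blast
  qed
  then have "span S = UNIV" using span_minimal[OF S(4)] by auto
  moreover have "reflect a ` K = K" "reflect a ` L = L" if "a \<in> S" for a
    using S(1) that by (simp_all add: R_def subset_iff)
  ultimately show ?thesis
    by (intro gaussian_log_brunn_minkowski_root_system[OF assms(1,2) S(3,2)] cpt)
qed

end
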